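(* Let $A\in\mathbb R^{n\times n}$ be symmetric with $[\lambda_{\min},\lambda_{\max}]=[-1,1]$, and let $[a,b]\subset[\lambda_{\min},\lambda_{\max}]$ with $a<b$. Let $\lambda_{ia},\lambda_{ib}$ and $\lambda_{oa},\lambda_{ob}$ be the eigenvalues of $A$ closest to the ends $a$ and $b$ inside and outside $[a,b]$, respectively. Define $$\Delta_{\min}=\min\{|\alpha-\arccos(\lambda_{ia})|,\ |\alpha-\arccos(\lambda_{oa})|,\ |\beta-\arccos(\lambda_{ib})|,\ |\beta-\arccos(\lambda_{ob})|\},$$ where $\alpha=\arccos(a)$, $\beta=\arccos(b)$. Let $M\ge1$ be an integer and $p\in\mathcal P_{M-1}$. Then for $\lambda\in\lambda(A)$ and $d\ge2$, $$|F_d(p)(\lambda)-p(\lambda)h(\lambda)|\le\frac{\pi^6\,\|p\|_{L_\infty(a,b)}}{\Delta_{\min}^4(d+2)^3}+\begin{cases}0,&\lambda\notin[a,b],\\[2pt] \dfrac{\pi^4(M-1)^4\,\|p\|_{L_\infty(a,b)}}{2(b-a)^2(d+2)^2},&\lambda\in(a,b),\\[6pt] \dfrac{\pi^2(M-1)^2\,\|p\|_{L_\infty(a,b)}}{2(b-a)(d+2)},&\lambda\in\{a,b\}.\end{cases}$$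
   Context: $\lambda(A)$ is the set of all eigenvalues of $A$, and $\lambda_{\min},\lambda_{\max}$ are the smallest and largest of them. $\mathcal P_{M-1}$ is the set of real polynomials of degree not exceeding $M-1$, and $\|f\|_{L_\infty(a,b)}=\sup_{t\in(a,b)}|f(t)|$. The step function $h$ is $h(t)=1$ for $t\in(a,b)$, $h(t)=\frac12$ for $t\in\{a,b\}$, $h(t)=0$ for $t\in[-1,1]\setminus[a,b]$. $T_j$ is the Chebyshev polynomial of the first kind of degree $j$. The Chebyshev--Jackson (CJ) series expansion of degree $d$ of $p\cdot h$ is the polynomial $$F_d(p)(t)=\frac{c_0}{2}+\sum_{j=1}^d\rho_{j,d}\,c_j\,T_j(t),\qquad c_j=\frac2\pi\int_a^b\frac{p(t)T_j(t)}{\sqrt{1-t^2}}\,dt,$$ with the Jackson damping factors $$\rho_{j,d}=\frac{\sin((j+1)\alpha_d)}{(d+2)\sin(\alpha_d)}+\Bigl(1-\frac{j+1}{d+2}\Bigr)\cos(j\alpha_d),\qquad \alpha_d=\frac{\pi}{d+2}.$$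
   Formalization: The case where λ is an end of [a,b] and also equals -1 or 1 is excluded: there the bound fails (p=1, [a,b]=[-1,0], λ=-1, eigenvalues ±1, ±1/2, d large) or Δ_min=0. Inside eigenvalues λ_ia, λ_ib are taken in the open interval (a,b), so that Δ_min>0. *)

theory Defs
  imports
    "HOL-Analysis.Analysis"
    "HOL-Computational_Algebra.Polynomial"
    "Jordan_Normal_Form.Spectral_Radius"
begin

fun cheb :: "nat \<Rightarrow> real poly" where
  "cheb 0 = 1"
| "cheb (Suc 0) = [:0, 1:]"
| "cheb (Suc (Suc n)) = [:0, 2:] * cheb (Suc n) - cheb n"

definition jackson_alpha :: "nat \<Rightarrow> real" where
  "jackson_alpha d = pi / (real d + 2)"

definition jackson_factor :: "nat \<Rightarrow> nat \<Rightarrow> real" where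
  "jackson_factor j d =
     sin ((real j + 1) * jackson_alpha d) / ((real d + 2) * sin (jackson_alpha d))
     + (1 - (real j + 1) / (real d + 2)) * cos (real j * jackson_alpha d)"

definition step_fun :: "real \<Rightarrow> real \<Rightarrow> real \<Rightarrow> real" where
  "step_fun a b t = (if a < t \<and> t < b then 1 else if t = a \<or> t = b then 1 / 2 else 0)"

text \<open>For \<open>a = -1\<close> or \<open>b = 1\<close> the integrand is unbounded but absolutely integrable;
  its value at the singular point (a division by zero) is irrelevant.\<close>

definition cheb_coeff :: "real \<Rightarrow> real \<Rightarrow> real poly \<Rightarrow> nat \<Rightarrow> real" where
  "cheb_coeff a b p j =
     2 / pi * integral {a..b} (\<lambda>t. poly p t * poly (cheb j) t / sqrt (1 - t\<^sup>2))"

definition CJ_series :: "real \<Rightarrow> real \<Rightarrow> nat \<Rightarrow> real poly \<Rightarrow> real poly" where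
  "CJ_series a b d p =
     [:cheb_coeff a b p 0 / 2:]
     + (\<Sum>j = 1..d. Polynomial.smult (jackson_factor j d * cheb_coeff a b p j) (cheb j))"

definition sup_norm :: "real \<Rightarrow> real \<Rightarrow> (real \<Rightarrow> real) \<Rightarrow> real" where
  "sup_norm a b f = (SUP t\<in>{a<..<b}. \<bar>f t\<bar>)"

text \<open>\<open>closest_in S c \<mu>\<close>: \<open>\<mu>\<close> is an element of \<open>S\<close> at minimal distance from \<open>c\<close>. For the
  eigenvalues inside \<open>[a,b]\<close> it is used with the open interval, so that an eigenvalue equal
  to \<open>a\<close> or \<open>b\<close> is allowed and does not force \<open>delta_min = 0\<close>.\<close>

definition closest_in :: "real set \<Rightarrow> real \<Rightarrow> real \<Rightarrow> bool" where
  "closest_in S c \<mu> \<longleftrightarrow> is_arg_min (\<lambda>x. \<bar>x - c\<bar>) (\<lambda>x. x \<in> S) \<mu>"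

definition delta_min :: "real \<Rightarrow> real \<Rightarrow> real \<Rightarrow> real \<Rightarrow> real \<Rightarrow> real \<Rightarrow> real" where
  "delta_min a b l_ia l_oa l_ib l_ob =
     Min {\<bar>arccos a - arccos l_ia\<bar>, \<bar>arccos a - arccos l_oa\<bar>,
          \<bar>arccos b - arccos l_ib\<bar>, \<bar>arccos b - arccos l_ob\<bar>}"

end

theory Submission
  imports Defs
begin

text \<open>In the variable \<open>\<theta> = arccos t\<close> the Chebyshev--Jackson series is the convolution of
  \<open>(p h)(cos \<theta>)\<close> with the nonnegative Jackson kernel, so the error is an average of
  \<open>(p h)(cos (\<theta> + s)) - (p h)(cos \<theta>)\<close>. The part \<open>\<bar>s\<bar> \<ge> \<Delta>\<close> is controlled by the fourth moment of the
  kernel, \<open>s ^ 4\<close> being dominated by \<open>(1 - cos s)\<^sup>2\<close>. For \<open>\<bar>s\<bar> < \<Delta>\<close> no jump of \<open>h\<close> is met except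
  at an end of \<open>[a,b]\<close>; there Taylor's formula applies (the linear term is odd and drops out, and
  at a jump only one side contributes), with derivatives of \<open>p (cos \<theta>)\<close> bounded by Markov's
  inequality on \<open>[a,b]\<close>, and the second moment of the kernel gives the remaining terms.\<close>

section \<open>Bernstein's and Markov's inequalities\<close>

text \<open>The rates come from the origin of the damping factors: they are normalised
  autocorrelations of sin ((k + 1) alpha_d), k <= d. Hence the kernel is nonnegative, and its
  moments need only the factors for j = 0, 1, 2: the mean of 1 - cos s is 1 - cos alpha_d = O(d^-2),
  and that of (1 - cos s)^2 is (1 - cos alpha_d)^2 + sin^2 alpha_d / (d + 2) = O(d^-3). Folding the
  circle onto [0, pi] adds a mirror image K (u + theta) of the kernel. It is far away as long as the
  window of radius Delta around theta stays inside [0, pi]; at an end of [a,b] this holds because -1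
  and 1 are eigenvalues. The obstacle is Delta itself: the closest eigenvalues are selected by
  distance in t, while the proof needs gaps in the angle, and the outside eigenvalue closest to a
  may lie beyond b. The gap on the near side of a must then be recovered by comparing arcs on the
  two sides of arccos a.\<close>

inductive trig_poly :: "nat \<Rightarrow> (real \<Rightarrow> real) \<Rightarrow> bool" for N where
  trig_poly_cos: "j \<le> N \<Longrightarrow> trig_poly N (\<lambda>x. cos (real j * x))"
| trig_poly_sin: "j \<le> N \<Longrightarrow> trig_poly N (\<lambda>x. sin (real j * x))"
| trig_poly_add: "trig_poly N f \<Longrightarrow> trig_poly N g \<Longrightarrow> trig_poly N (\<lambda>x. f x + g x)"
| trig_poly_cmult: "trig_poly N f \<Longrightarrow> trig_poly N (\<lambda>x. c * f x)"

lemma trig_poly_mono: "trig_poly N f \<Longrightarrow> N \<le> N' \<Longrightarrow> trig_poly N' f"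
  by (induction rule: trig_poly.induct) (rule trig_poly.intros; simp)+

lemma trig_poly_const: "trig_poly N (\<lambda>x. c)"
  using trig_poly_cmult[OF trig_poly_cos[of 0 N], of c] by simp

lemma trig_poly_cos_mult:
  assumes "trig_poly N f"
  shows "trig_poly (Suc N) (\<lambda>x. cos x * f x)"
  using assms
proof (induction rule: trig_poly.induct)
  case (trig_poly_cos j)
  show ?case
  proof (cases j)
    case 0
    then show ?thesis using trig_poly.trig_poly_cos[of 1 "Suc N"] by simp
  next
    case (Suc i)
    have "cos x * cos (real j * x) = 1/2 * (cos (real (Suc j) * x) + cos (real i * x))" for x
      using cos_times_cos[of x "real j * x"] cos_minus[of "x - real j * x"]
      by (simp add: Suc algebra_simps)
    moreover have "trig_poly (Suc N) (\<lambda>x. 1/2 * (cos (real (Suc j) * x) + cos (real i * x)))"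
      using trig_poly_cos Suc
      by (intro trig_poly_cmult trig_poly_add trig_poly.trig_poly_cos) simp_all
    ultimately show ?thesis by (simp only:)
  qed
next
  case (trig_poly_sin j)
  show ?case
  proof (cases j)
    case 0
    then show ?thesis using trig_poly_const[of "Suc N" 0] by simp
  next
    case (Suc i)
    have "cos x * sin (real j * x) = 1/2 * (sin (real (Suc j) * x) + sin (real i * x))" for x
      using sin_times_cos[of "real j * x" x] by (simp add: Suc algebra_simps)
    moreover have "trig_poly (Suc N) (\<lambda>x. 1/2 * (sin (real (Suc j) * x) + sin (real i * x)))"
      using trig_poly_sin Suc
      by (intro trig_poly_cmult trig_poly_add trig_poly.trig_poly_sin) simp_all
    ultimately show ?thesis by (simp only:)
  qed
next
  case (trig_poly_add f g)
  then show ?case unfolding distrib_left by (intro trig_poly.trig_poly_add)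
next
  case (trig_poly_cmult f c)
  then show ?case
    unfolding mult.left_commute[of "cos _" c] by (intro trig_poly.trig_poly_cmult)
qed

lemma trig_poly_sin_mult:
  assumes "trig_poly N f"
  shows "trig_poly (Suc N) (\<lambda>x. sin x * f x)"
  using assms
proof (induction rule: trig_poly.induct)
  case (trig_poly_cos j)
  show ?case
  proof (cases j)
    case 0
    then show ?thesis using trig_poly.trig_poly_sin[of 1 "Suc N"] by simp
  next
    case (Suc i)
    have "sin x * cos (real j * x) = 1/2 * (sin (real (Suc j) * x) + (-1) * sin (real i * x))" for x
      using sin_times_cos[of x "real j * x"] sin_minus[of "x - real j * x"]
      by (simp add: Suc algebra_simps)
    moreover have "trig_poly (Suc N)
        (\<lambda>x. 1/2 * (sin (real (Suc j) * x) + (-1) * sin (real i * x)))"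
      using trig_poly_cos Suc
      by (intro trig_poly_cmult trig_poly_add trig_poly.trig_poly_sin) simp_all
    ultimately show ?thesis by (simp only:)
  qed
next
  case (trig_poly_sin j)
  show ?case
  proof (cases j)
    case 0
    then show ?thesis using trig_poly_const[of "Suc N" 0] by simp
  next
    case (Suc i)
    have "sin x * sin (real j * x) = 1/2 * (cos (real i * x) + (-1) * cos (real (Suc j) * x))" for x
      using sin_times_sin[of x "real j * x"] cos_minus[of "x - real j * x"]
      by (simp add: Suc algebra_simps)
    moreover have "trig_poly (Suc N)
        (\<lambda>x. 1/2 * (cos (real i * x) + (-1) * cos (real (Suc j) * x)))"
      using trig_poly_sin Suc
      by (intro trig_poly_cmult trig_poly_add trig_poly.trig_poly_cos) simp_all
    ultimately show ?thesis by (simp only:)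
  qed
next
  case (trig_poly_add f g)
  then show ?case unfolding distrib_left by (intro trig_poly.trig_poly_add)
next
  case (trig_poly_cmult f c)
  then show ?case
    unfolding mult.left_commute[of "sin _" c] by (intro trig_poly.trig_poly_cmult)
qed

lemma trig_poly_poly_cos: "trig_poly (degree p) (\<lambda>x. poly p (cos x))"
proof (induction p)
  case 0
  then show ?case by (simp add: trig_poly_const)
next
  case (pCons a p)
  show ?case
  proof (cases "p = 0")
    case True
    then show ?thesis by (simp add: trig_poly_const)
  next
    case False
    then show ?thesis
      using trig_poly_cos_mult[OF pCons.IH] by (simp add: trig_poly_add trig_poly_const)
  qed
qed

section \<open>M. Riesz's interpolation formula for the derivative\<close>

definition riesz_node :: "nat \<Rightarrow> nat \<Rightarrow> real" where
  "riesz_node N k = (2 * real k + 1) * pi / (2 * real N)"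

text \<open>For k < 2 N the nodes are the zeros of cos (N x) in (0, 2 pi). Divided by 4 N, the
  weights are those with which the values of a trigonometric polynomial of degree N, shifted by the
  nodes, add up to its derivative.\<close>

definition riesz_weight :: "nat \<Rightarrow> nat \<Rightarrow> real" where
  "riesz_weight N k = (-1) ^ k / (sin (riesz_node N k / 2))\<^sup>2"

lemma sin_half_riesz_node_pos:
  assumes "k < 2 * N"
  shows "sin (riesz_node N k / 2) > 0"
proof (rule sin_gt_zero)
  show "0 < riesz_node N k / 2" using assms by (simp add: riesz_node_def)
  have "2 * real k + 1 < 4 * real N" using assms by linarith
  then have "pi * (2 * real k + 1) < pi * (4 * real N)" by simp
  then show "riesz_node N k / 2 < pi"
    using assms by (simp add: riesz_node_def field_simps)
qed

lemma cos_N_riesz_node: "N > 0 \<Longrightarrow> cos (real N * riesz_node N k) = 0"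
  and sin_N_riesz_node: "N > 0 \<Longrightarrow> sin (real N * riesz_node N k) = (-1) ^ k"
proof -
  assume "N > 0"
  then have "real N * riesz_node N k = pi / 2 + real k * pi"
    by (simp add: riesz_node_def field_simps)
  then show "cos (real N * riesz_node N k) = 0" "sin (real N * riesz_node N k) = (-1) ^ k"
    by (simp_all add: cos_add sin_add)
qed

text \<open>Multiplication by 2 cos y turns each term into a sum of two neighbouring sines, and the
  alternating signs make the sum telescope. The factor can be cancelled because \<open>j < N\<close>
  puts y below pi / 2; at j = N it vanishes, and the sum is 2 N instead.\<close>

lemma sum_alternating_sin_riesz_node:
  assumes "j < N"
  shows "(\<Sum>k<2*N. (-1) ^ k * sin (real j * riesz_node N k)) = 0"
proof -
  define y where "y = real j * pi / (2 * real N)"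
  have N: "N > 0" using assms by simp
  have node: "real j * riesz_node N k = (2 * real k + 1) * y" for k
    by (simp add: riesz_node_def y_def)
  have "2 * cos y * (\<Sum>k<n. (-1) ^ k * sin ((2 * real k + 1) * y))
      = - ((-1) ^ n * sin (2 * real n * y))" for n
  proof (induction n)
    case (Suc n)
    have *: "2 * cos y * sin ((2 * real n + 1) * y) = sin (2 * real n * y) + sin (2 * real (Suc n) * y)"
      using sin_times_cos[of "(2 * real n + 1) * y" y] by (simp add: algebra_simps)
    have "2 * cos y * (\<Sum>k<Suc n. (-1) ^ k * sin ((2 * real k + 1) * y))
        = - ((-1) ^ n * sin (2 * real n * y)) + (-1) ^ n * (2 * cos y * sin ((2 * real n + 1) * y))"
      using Suc by (simp add: distrib_left mult_ac)
    also have "\<dots> = - ((-1) ^ Suc n * sin (2 * real (Suc n) * y))"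
      unfolding * by (simp add: algebra_simps)
    finally show ?case .
  qed simp
  from this[of "2 * N"]
  have "2 * cos y * (\<Sum>k<2*N. (-1) ^ k * sin ((2 * real k + 1) * y)) = - sin (2 * real (2 * N) * y)"
    by simp
  also have "2 * real (2 * N) * y = 2 * pi * real j"
    using N by (simp add: y_def)
  also have "sin (2 * pi * real j) = 0"
    using sin_npi2[of "2 * j"] by (simp add: mult_ac)
  finally have "2 * cos y * (\<Sum>k<2*N. (-1) ^ k * sin ((2 * real k + 1) * y)) = 0" by simp
  moreover have "cos y > 0"
  proof (rule cos_gt_zero_pi)
    show "- (pi / 2) < y"
      by (rule less_le_trans[of _ 0]) (simp_all add: y_def)
    show "y < pi / 2" using assms by (simp add: y_def field_simps)
  qed
  ultimately show ?thesis by (simp add: node)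
qed

text \<open>The reflection k -> 2 N - 1 - k sends a node x to 2 pi - x. It preserves the cosine and
  sin (x / 2) but changes the parity of k, so the terms cancel in pairs.\<close>

lemma sum_riesz_weight_cos:
  assumes "N > 0"
  shows "(\<Sum>k<2*N. riesz_weight N k * cos (real j * riesz_node N k)) = 0" (is "?S = 0")
proof -
  have "?S = (\<Sum>k<2*N. riesz_weight N (2*N - Suc k) * cos (real j * riesz_node N (2*N - Suc k)))"
    by (rule sum.nat_diff_reindex[symmetric])
  also have "\<dots> = (\<Sum>k<2*N. - (riesz_weight N k * cos (real j * riesz_node N k)))"
  proof (rule sum.cong)
    fix k assume "k \<in> {..<2*N}"
    then have k: "Suc k \<le> 2 * N" by simp
    have node: "riesz_node N (2*N - Suc k) = 2 * pi - riesz_node N k"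
      using k assms by (simp add: riesz_node_def of_nat_diff field_simps)
    have "(-1::real) ^ (2*N - Suc k) = - ((-1) ^ k)"
      using k by (auto simp: minus_one_power_iff)
    moreover have "sin (riesz_node N (2*N - Suc k) / 2) = sin (riesz_node N k / 2)"
      unfolding node by (simp add: diff_divide_distrib)
    moreover have "cos (real j * riesz_node N (2*N - Suc k)) = cos (real j * riesz_node N k)"
    proof -
      have "real j * riesz_node N (2*N - Suc k) = 2 * pi * real j - real j * riesz_node N k"
        unfolding node by (simp add: algebra_simps)
      moreover have "cos (2 * pi * real j) = 1" "sin (2 * pi * real j) = 0"
        using sin_npi2[of "2 * j"] cos_npi2[of "2 * j"] by (simp_all add: mult_ac)
      ultimately show ?thesis by (simp add: cos_diff)
    qed
    ultimately show "riesz_weight N (2*N - Suc k) * cos (real j * riesz_node N (2*N - Suc k))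
        = - (riesz_weight N k * cos (real j * riesz_node N k))"
      by (simp add: riesz_weight_def)
  qed simp
  finally show ?thesis by (simp add: sum_negf)
qed

text \<open>Multiplying by \<open>sin\<^sup>2 (x / 2)\<close> is, up to a factor, taking second differences of the
  frequency; so the sums below are affine in \<open>j\<close> for \<open>j \<le> N\<close>, and the second difference
  at \<open>N\<close>, where the sum is symmetric, fixes the slope.\<close>

lemma sum_riesz_weight_sin:
  assumes "N > 0" "j \<le> N"
  shows "(\<Sum>k<2*N. riesz_weight N k * sin (real j * riesz_node N k)) = 4 * real N * real j"
proof -
  define V where "V j = (\<Sum>k<2*N. riesz_weight N k * sin (real j * riesz_node N k))" for j
  have second_diff: "V (Suc (Suc i)) + V i - 2 * V (Suc i)
      = - 4 * (\<Sum>k<2*N. (-1) ^ k * sin (real (Suc i) * riesz_node N k))" for i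
  proof -
    have *: "riesz_weight N k * sin (real (Suc (Suc i)) * riesz_node N k)
          + riesz_weight N k * sin (real i * riesz_node N k)
          - 2 * (riesz_weight N k * sin (real (Suc i) * riesz_node N k))
        = - 4 * ((-1) ^ k * sin (real (Suc i) * riesz_node N k))" if "k < 2 * N" for k
    proof -
      define x where "x = riesz_node N k"
      have "sin (real (Suc (Suc i)) * x) + sin (real i * x) = 2 * sin (real (Suc i) * x) * cos x"
        using sin_times_cos[of "real (Suc i) * x" x] by (simp add: algebra_simps)
      moreover have "cos x = 1 - 2 * (sin (x / 2))\<^sup>2"
        using cos_double_sin[of "x / 2"] by simp
      ultimately have "sin (real (Suc (Suc i)) * x) + sin (real i * x) - 2 * sin (real (Suc i) * x)
          = 2 * sin (real (Suc i) * x) * (1 - 2 * (sin (x / 2))\<^sup>2) - 2 * sin (real (Suc i) * x)"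
        by (simp only:)
      also have "\<dots> = - 4 * (sin (x / 2))\<^sup>2 * sin (real (Suc i) * x)"
        by (simp add: right_diff_distrib)
      finally have "riesz_weight N k * (sin (real (Suc (Suc i)) * x) + sin (real i * x)
            - 2 * sin (real (Suc i) * x))
          = riesz_weight N k * (- 4 * (sin (x / 2))\<^sup>2 * sin (real (Suc i) * x))"
        by simp
      also have "riesz_weight N k * (sin (x / 2))\<^sup>2 = (-1) ^ k"
        using sin_half_riesz_node_pos[OF that] by (simp add: riesz_weight_def x_def)
      then have "riesz_weight N k * (- 4 * (sin (x / 2))\<^sup>2 * sin (real (Suc i) * x))
          = - 4 * ((-1) ^ k * sin (real (Suc i) * x))"
        by (simp add: mult_ac)
      finally show ?thesis by (simp add: algebra_simps x_def)
    qed
    show ?thesis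
      unfolding V_def sum_distrib_left sum.distrib[symmetric] sum_subtractf[symmetric]
      by (rule sum.cong) (use * in auto)
  qed
  have V0: "V 0 = 0" by (simp add: V_def)
  have lin: "V i = real i * V 1 \<and> V (Suc i) = real (Suc i) * V 1" if "i < N" for i
    using that
  proof (induction i)
    case 0
    then show ?case using V0 by simp
  next
    case (Suc i)
    then have "V (Suc (Suc i)) + V i - 2 * V (Suc i) = 0"
      using second_diff[of i] sum_alternating_sin_riesz_node[of "Suc i" N] by simp
    with Suc show ?case by (simp add: algebra_simps)
  qed
  obtain m where m: "N = Suc m" using assms by (cases N) auto
  \<comment> \<open>cos (N x) = 0 at every node, so sin ((N + 1) x) and sin ((N - 1) x) agree there.
    The second difference at N is thus 2 V (N - 1) - 2 V N, and the alternating sum 2 N makes it -8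
    N; hence the slope 4 N.\<close>
  have "V (Suc N) = V m"
    unfolding V_def
  proof (rule sum.cong)
    fix k assume "k \<in> {..<2*N}"
    have "real (Suc N) * riesz_node N k = real N * riesz_node N k + riesz_node N k"
      "real m * riesz_node N k = real N * riesz_node N k - riesz_node N k"
      by (simp_all add: m algebra_simps)
    then show "riesz_weight N k * sin (real (Suc N) * riesz_node N k)
        = riesz_weight N k * sin (real m * riesz_node N k)"
      using cos_N_riesz_node[OF assms(1)] by (simp add: sin_add sin_diff)
  qed simp
  moreover have "(\<Sum>k<2*N. (-1) ^ k * sin (real N * riesz_node N k)) = 2 * real N"
    unfolding sin_N_riesz_node[OF assms(1)] by (simp flip: power_mult_distrib)
  ultimately have "2 * V m - 2 * V N = - 8 * real N"
    using second_diff[of m] by (simp add: m)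
  with lin[of m] have "V 1 = 4 * real N" by (simp add: m algebra_simps)
  moreover have "V j = real j * V 1"
  proof (cases j)
    case 0
    then show ?thesis using V0 by simp
  next
    case (Suc i)
    then show ?thesis using lin[of i] assms by simp
  qed
  ultimately have "V j = 4 * real N * real j" by simp
  then show ?thesis by (simp add: V_def)
qed

text \<open>Both sides are linear in f, so rule induction reduces the claim to the generators. There
  the addition theorem separates x from the nodes and leaves the cosine sums, which vanish, and the
  sine sums 4 N j.\<close>

lemma riesz_interpolation:
  assumes "N > 0" "trig_poly N f"
  shows "(f has_real_derivative
           (\<Sum>k<2*N. riesz_weight N k * f (x + riesz_node N k)) / (4 * real N)) (at x)"
  using assms(2)
proof (induction rule: trig_poly.induct)
  case (trig_poly_cos j)
  let ?\<theta> = "\<lambda>k. real j * riesz_node N k"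
  have "(\<Sum>k<2*N. riesz_weight N k * cos (real j * (x + riesz_node N k)))
      = (\<Sum>k<2*N. cos (real j * x) * (riesz_weight N k * cos (?\<theta> k))
           - sin (real j * x) * (riesz_weight N k * sin (?\<theta> k)))"
    by (rule sum.cong) (simp_all add: distrib_left cos_add algebra_simps)
  also have "\<dots> = - (4 * real N * (real j * sin (real j * x)))"
    unfolding sum_subtractf sum_distrib_left[symmetric]
    using sum_riesz_weight_cos[OF assms(1)] sum_riesz_weight_sin[OF assms(1) trig_poly_cos]
    by simp
  finally have "(\<Sum>k<2*N. riesz_weight N k * cos (real j * (x + riesz_node N k))) / (4 * real N)
      = - real j * sin (real j * x)" using assms(1) by simp
  moreover have "((\<lambda>x. cos (real j * x)) has_real_derivative - real j * sin (real j * x)) (at x)"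
    by (auto intro!: derivative_eq_intros)
  ultimately show ?case by simp
next
  case (trig_poly_sin j)
  let ?\<theta> = "\<lambda>k. real j * riesz_node N k"
  have "(\<Sum>k<2*N. riesz_weight N k * sin (real j * (x + riesz_node N k)))
      = (\<Sum>k<2*N. sin (real j * x) * (riesz_weight N k * cos (?\<theta> k))
           + cos (real j * x) * (riesz_weight N k * sin (?\<theta> k)))"
    by (rule sum.cong) (simp_all add: distrib_left sin_add algebra_simps)
  also have "\<dots> = 4 * real N * (real j * cos (real j * x))"
    unfolding sum.distrib sum_distrib_left[symmetric]
    using sum_riesz_weight_cos[OF assms(1)] sum_riesz_weight_sin[OF assms(1) trig_poly_sin]
    by simp
  finally have "(\<Sum>k<2*N. riesz_weight N k * sin (real j * (x + riesz_node N k))) / (4 * real N)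
      = real j * cos (real j * x)" using assms(1) by simp
  moreover have "((\<lambda>x. sin (real j * x)) has_real_derivative real j * cos (real j * x)) (at x)"
    by (auto intro!: derivative_eq_intros)
  ultimately show ?case by simp
next
  case (trig_poly_add f g)
  then show ?case
    by (auto intro!: derivative_eq_intros simp: distrib_left sum.distrib add_divide_distrib)
next
  case (trig_poly_cmult f c)
  have "((\<lambda>x. c * f x) has_real_derivative
      c * ((\<Sum>k<2*N. riesz_weight N k * f (x + riesz_node N k)) / (4 * real N))) (at x)"
    by (rule DERIV_cmult[OF trig_poly_cmult.IH])
  then show ?case by (simp add: sum_distrib_left mult_ac)
qed

section \<open>The inequalities of Bernstein, Schur and Markov\<close>

theorem bernstein_inequality:
  assumes f: "trig_poly N f" and B: "\<And>x. \<bar>f x\<bar> \<le> B"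
    and f': "(f has_real_derivative f') (at x)"
  shows "\<bar>f'\<bar> \<le> real N * B"
proof (cases "N = 0")
  case True
  have "\<exists>c. f = (\<lambda>x. c)" using f unfolding True
    by (induction rule: trig_poly.induct) auto
  then obtain c where "f = (\<lambda>x. c)" ..
  then have "f' = 0" using f' DERIV_unique[OF _ DERIV_const] by blast
  with True show ?thesis by simp
next
  case False
  then have N: "N > 0" by simp
  \<comment> \<open>The weights have the signs of sin (N x) at the nodes. The sum of their absolute
    values is therefore the sine sum at j = N, which is 4 N^2; division by 4 N gives exactly the
    factor N.\<close>
  have abs_weight: "\<bar>riesz_weight N k\<bar> = riesz_weight N k * sin (real N * riesz_node N k)" for k
    unfolding sin_N_riesz_node[OF N]
    by (simp add: riesz_weight_def abs_mult power_abs flip: power_mult_distrib)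
  have "f' = (\<Sum>k<2*N. riesz_weight N k * f (x + riesz_node N k)) / (4 * real N)"
    by (rule DERIV_unique[OF f' riesz_interpolation[OF N f]])
  also have "\<bar>\<dots>\<bar> \<le> (\<Sum>k<2*N. \<bar>riesz_weight N k\<bar> * B) / (4 * real N)"
  proof -
    have "\<bar>\<Sum>k<2*N. riesz_weight N k * f (x + riesz_node N k)\<bar>
        \<le> (\<Sum>k<2*N. \<bar>riesz_weight N k * f (x + riesz_node N k)\<bar>)" by (rule sum_abs)
    also have "\<dots> \<le> (\<Sum>k<2*N. \<bar>riesz_weight N k\<bar> * B)"
      by (intro sum_mono) (simp add: abs_mult B mult_left_mono)
    finally show ?thesis using N by (simp add: divide_right_mono)
  qed
  also have "\<dots> = real N * B"
    using N sum_riesz_weight_sin[OF N order_refl]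
    by (simp add: abs_weight sum_distrib_right[symmetric])
  finally show ?thesis .
qed

lemma bernstein_poly:
  assumes p: "degree p \<le> N" and B: "\<And>x. \<bar>x\<bar> \<le> 1 \<Longrightarrow> \<bar>poly p x\<bar> \<le> B"
  shows "\<bar>poly (pderiv p) (cos t) * sin t\<bar> \<le> real N * B"
proof -
  have "((\<lambda>x. poly p (cos x)) has_real_derivative poly (pderiv p) (cos t) * (- sin t)) (at t)"
    by (auto intro!: derivative_eq_intros)
  then have "\<bar>poly (pderiv p) (cos t) * (- sin t)\<bar> \<le> real N * B"
    by (rule bernstein_inequality[rotated 2])
       (use trig_poly_mono[OF trig_poly_poly_cos p] B in auto)
  then show ?thesis by simp
qed

text \<open>Schur: \<open>q (cos t) sin t\<close> is an odd trigonometric polynomial with derivative \<open>q 1\<close> at \<open>0\<close>;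
  other points \<open>y\<close> are reached by the dilation \<open>x \<mapsto> y * x\<close>, which preserves the hypothesis.\<close>

lemma schur_inequality:
  assumes q: "degree q < N" and B: "\<And>t. \<bar>poly q (cos t) * sin t\<bar> \<le> B" and y: "\<bar>y\<bar> \<le> 1"
  shows "\<bar>poly q y\<bar> \<le> real N * B"
proof -
  define r where "r = pcompose q [:0, y:]"
  have r: "poly r x = poly q (y * x)" for x by (simp add: r_def poly_pcompose mult.commute)
  have "degree r \<le> degree q" by (auto simp: r_def intro: order.trans[OF degree_pcompose_le])
  then have "trig_poly N (\<lambda>t. sin t * poly r (cos t))"
    using q trig_poly_mono[OF trig_poly_sin_mult[OF trig_poly_poly_cos]] by auto
  moreover have "\<bar>sin t * poly r (cos t)\<bar> \<le> B" for t
  proof -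
    have yc: "\<bar>y * cos t\<bar> \<le> 1"
      using y by (simp add: abs_mult mult_le_one)
    \<comment> \<open>At the angle s with cos s = y cos t the hypothesis bounds |q (y cos t) sin s|.
      As |cos s| <= |cos t|, replacing sin s by sin t does not increase this.\<close>
    define s where "s = arccos (y * cos t)"
    have s: "cos s = y * cos t" using yc by (simp add: s_def cos_arccos_abs)
    have "y\<^sup>2 \<le> 1" using y by (simp add: abs_square_le_1)
    then have "(cos s)\<^sup>2 \<le> (cos t)\<^sup>2"
      unfolding s power_mult_distrib by (simp add: mult_left_le_one_le)
    then have "\<bar>sin t\<bar> \<le> \<bar>sin s\<bar>"
      by (simp add: abs_le_square_iff sin_squared_eq)
    then have "\<bar>sin t * poly r (cos t)\<bar> \<le> \<bar>poly q (cos s) * sin s\<bar>"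
      by (simp add: abs_mult r s mult_mono' mult.commute)
    with B[of s] show ?thesis by linarith
  qed
  moreover have "((\<lambda>t. sin t * poly r (cos t)) has_real_derivative poly r 1) (at 0)"
    by (auto intro!: derivative_eq_intros)
  ultimately have "\<bar>poly r 1\<bar> \<le> real N * B" by (rule bernstein_inequality)
  then show ?thesis by (simp add: r)
qed

text \<open>Bernstein's inequality bounds p' (cos t) sin t by N B, and Schur's inequality for p', of
  degree below N, removes the sine at the cost of a second factor N.\<close>

theorem markov_inequality:
  assumes p: "degree p \<le> N" and B: "\<And>x. \<bar>x\<bar> \<le> 1 \<Longrightarrow> \<bar>poly p x\<bar> \<le> B" and y: "\<bar>y\<bar> \<le> 1"
  shows "\<bar>poly (pderiv p) y\<bar> \<le> (real N)\<^sup>2 * B"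
proof (cases "N = 0")
  case True
  with p have "pderiv p = 0" by (simp add: pderiv_eq_0_iff)
  then show ?thesis using True by simp
next
  case False
  have "\<bar>poly (pderiv p) y\<bar> \<le> real N * (real N * B)"
    by (rule schur_inequality[OF _ bernstein_poly[OF p B] y])
       (use p False in \<open>auto simp: degree_pderiv\<close>)
  then show ?thesis by (simp add: power2_eq_square mult.assoc)
qed

lemma markov_inequality_Icc:
  fixes p :: "real poly"
  assumes "a < b" and p: "degree p \<le> N" and B: "\<And>x. x \<in> {a..b} \<Longrightarrow> \<bar>poly p x\<bar> \<le> B"
    and y: "y \<in> {a..b}"
  shows "\<bar>poly (pderiv p) y\<bar> \<le> 2 * (real N)\<^sup>2 / (b - a) * B"
proof -
  define h where "h = (b - a) / 2"
  define r where "r = pcompose p [:(a + b) / 2, h:]"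
  have h: "h > 0" using assms(1) by (simp add: h_def)
  have r: "poly r x = poly p ((a + b) / 2 + x * h)" for x
    by (simp add: r_def poly_pcompose)
  have r': "poly (pderiv r) x = h * poly (pderiv p) ((a + b) / 2 + x * h)" for x
    by (simp add: r_def pderiv_pcompose poly_pcompose pderiv_pCons)
  have "degree r \<le> N" using p by (auto simp: r_def intro: order.trans[OF degree_pcompose_le])
  moreover have "\<bar>poly r x\<bar> \<le> B" if "\<bar>x\<bar> \<le> 1" for x
  proof -
    have "\<bar>x * h\<bar> \<le> h" using that h by (simp add: abs_mult)
    then show ?thesis unfolding r h_def by (intro B) (auto simp: abs_le_iff field_simps)
  qed
  moreover have "\<bar>(y - (a + b) / 2) / h\<bar> \<le> 1"
    using y assms(1) by (auto simp: h_def abs_le_iff field_simps)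
  ultimately have "\<bar>poly (pderiv r) ((y - (a + b) / 2) / h)\<bar> \<le> (real N)\<^sup>2 * B"
    by (rule markov_inequality)
  then have "h * \<bar>poly (pderiv p) y\<bar> \<le> (real N)\<^sup>2 * B"
    using h by (simp add: r' abs_mult)
  then show ?thesis using h by (simp add: h_def field_simps)
qed

section \<open>Elementary trigonometric estimates\<close>

text \<open>Concavity puts the sine above its chord over [0, w]. The form without quotients admits v
  = 0.\<close>

lemma sin_div_decreasing:
  assumes "0 \<le> v" "v \<le> w" "w \<le> pi"
  shows "v * sin w \<le> w * sin v"
proof (cases "w = 0")
  case False
  have "concave_on {0..pi} sin"
    by (rule f''_le0_imp_concave[where f' = cos and f'' = "\<lambda>x. - sin x"])
       (auto intro!: derivative_eq_intros sin_ge_zero)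
  from concave_onD[OF this, of "v / w" 0 w] assms False
  have "v / w * sin w \<le> sin v" by simp
  then show ?thesis using False assms by (simp add: field_simps)
qed (use assms in simp)

lemma one_minus_cos_eq: "1 - cos x = 2 * (sin (x / 2))\<^sup>2" for x :: real
  using cos_double_sin[of "x / 2"] by simp

lemma one_minus_cos_le: "1 - cos x \<le> x\<^sup>2 / 2" for x :: real
proof -
  have "(sin (x / 2))\<^sup>2 \<le> (x / 2)\<^sup>2"
    using abs_sin_x_le_abs_x[of "x / 2"] by (simp only: abs_le_square_iff)
  then show ?thesis unfolding one_minus_cos_eq by (simp add: power_divide)
qed

text \<open>Jordan's inequality |s| <= pi sin (|s| / 2), squared. Together with alpha_d = pi / (d +
  2) it accounts for all powers of pi in the final bound.\<close>

lemma square_le_one_minus_cos: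
  assumes "\<bar>s\<bar> \<le> pi"
  shows "s\<^sup>2 \<le> pi\<^sup>2 / 2 * (1 - cos s)"
proof -
  have "\<bar>s\<bar> / 2 * sin (pi / 2) \<le> pi / 2 * sin (\<bar>s\<bar> / 2)"
    by (rule sin_div_decreasing) (use assms in auto)
  also have "sin (\<bar>s\<bar> / 2) \<le> \<bar>sin (s / 2)\<bar>"
    by (cases "s \<ge> 0") auto
  then have "pi / 2 * sin (\<bar>s\<bar> / 2) \<le> pi / 2 * \<bar>sin (s / 2)\<bar>"
    by (rule mult_left_mono) simp
  finally have "\<bar>s\<bar> \<le> \<bar>pi * sin (s / 2)\<bar>" by (simp add: abs_mult)
  then have "s\<^sup>2 \<le> (pi * sin (s / 2))\<^sup>2" by (simp only: abs_le_square_iff)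
  then show ?thesis unfolding one_minus_cos_eq by (simp add: power_mult_distrib)
qed

text \<open>With \<open>k = sin al / al\<close>, the function \<open>cos u + k u\<^sup>2 / 2\<close> has its minimum over
  \<open>[0, pi]\<close> at \<open>al\<close>, which turns the hypothesis into \<open>2 al\<^sup>2 \<le> v\<^sup>2 + w\<^sup>2\<close>.\<close>

lemma cos_gap_reflect:
  fixes al v w :: real
  assumes "0 \<le> v" "v < al" "al \<le> w" "w \<le> pi" and gap: "cos v - cos al \<le> cos al - cos w"
  shows "al - v \<le> 3 * (w - al)"
proof (cases "al = pi")
  case True
  then have "cos v \<le> cos al" using assms by simp
  moreover have "cos al < cos v" using assms by (intro cos_monotone_0_pi) auto
  ultimately show ?thesis by simp
next
  case False
  define k where "k = sin al / al"
  define G where "G u = cos u + k * u\<^sup>2 / 2" for u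
  have al: "al > 0" "al < pi" using assms False by auto
  then have k: "k > 0" by (simp add: k_def sin_gt_zero)
  have G': "(G has_real_derivative k * u - sin u) (at u)" for u
    unfolding G_def by (auto intro!: derivative_eq_intros)
  have "G al \<le> G v"
  proof (rule DERIV_nonpos_imp_nonincreasing[of v al])
    fix u assume "v \<le> u" "u \<le> al"
    then show "\<exists>y. (G has_real_derivative y) (at u) \<and> y \<le> 0"
      using G'[of u] sin_div_decreasing[of u al] assms al by (force simp: k_def field_simps)
  qed (use assms in simp)
  moreover have "G al \<le> G w"
  proof (rule DERIV_nonneg_imp_nondecreasing[of al w])
    fix u assume "al \<le> u" "u \<le> w"
    then show "\<exists>y. (G has_real_derivative y) (at u) \<and> 0 \<le> y"
      using G'[of u] sin_div_decreasing[of al u] assms al by (force simp: k_def field_simps)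
  qed (use assms in simp)
  ultimately have "k * (2 * al\<^sup>2) \<le> k * (v\<^sup>2 + w\<^sup>2)"
    using gap unfolding G_def by (simp add: algebra_simps)
  then have sq: "2 * al\<^sup>2 \<le> v\<^sup>2 + w\<^sup>2" using k by simp
  show ?thesis
  proof (rule ccontr)
    assume neg: "\<not> al - v \<le> 3 * (w - al)"
    define x y where "x = al - v" and "y = w - al"
    have xy: "3 * y < x" "x \<le> al" "0 \<le> y" "0 < x"
      using neg assms by (auto simp: x_def y_def)
    \<comment> \<open>Since x > 3 y and x <= al, the right-hand side is at most 10/9 x^2 + 2/3 al x
      <= 16/9 al x, which is less than 2 al x.\<close>
    have "2 * al * x \<le> x\<^sup>2 + (2 * al * y + y\<^sup>2)"
      using sq by (simp add: x_def y_def power2_eq_square algebra_simps)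
    also have "2 * al * y \<le> 2 * al * (x / 3)" using xy al by (intro mult_left_mono) auto
    also have "y\<^sup>2 \<le> (x / 3)\<^sup>2" using xy by (intro power_mono) auto
    also have "x\<^sup>2 + (2 * al * (x / 3) + (x / 3)\<^sup>2) = x * (10 / 9 * x + 2 / 3 * al)"
      by (simp add: power2_eq_square algebra_simps)
    finally have "x * (2 * al) \<le> x * (10 / 9 * x + 2 / 3 * al)" by (simp add: mult_ac)
    then show False using xy by simp
  qed
qed

section \<open>The Jackson kernel\<close>

text \<open>The term 1 / 2 is half of \<open>jackson_factor 0 d\<close>: in exponentials the kernel
  is half the sum of rho_|j| exp (i j s) over |j| <= d, and its integral over a period is
  pi.\<close>

definition jackson_kernel :: "nat \<Rightarrow> real \<Rightarrow> real" where
  "jackson_kernel d s = 1 / 2 + (\<Sum>j=1..d. jackson_factor j d * cos (real j * s))"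

lemma sin_jackson_alpha_pos: "sin (jackson_alpha d) > 0"
proof (rule sin_gt_zero)
  show "0 < jackson_alpha d" by (simp add: jackson_alpha_def add_nonneg_pos)
  have "pi * 1 < pi * (real d + 2)" by (rule mult_strict_left_mono) auto
  then show "jackson_alpha d < pi"
    by (simp add: jackson_alpha_def pos_divide_less_eq)
qed

lemma sum_cos_arith_progression:
  "2 * sin x * (\<Sum>k\<le>n. cos ((2 * real k + c) * x))
     = sin ((2 * real n + c + 1) * x) - sin ((c - 1) * x)"
proof (induction n)
  case 0
  show ?case using cos_times_sin[of "c * x" x] by (simp add: algebra_simps)
next
  case (Suc n)
  have "2 * sin x * (\<Sum>k\<le>Suc n. cos ((2 * real k + c) * x))
      = 2 * sin x * (\<Sum>k\<le>n. cos ((2 * real k + c) * x))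
        + 2 * (cos ((2 * real (Suc n) + c) * x) * sin x)"
    by (simp add: distrib_left)
  also have "2 * (cos ((2 * real (Suc n) + c) * x) * sin x)
      = sin ((2 * real (Suc n) + c + 1) * x) - sin ((2 * real n + c + 1) * x)"
    using cos_times_sin[of "(2 * real (Suc n) + c) * x" x] by (simp add: algebra_simps)
  finally show ?case using Suc by simp
qed

text \<open>Each product of sines is half a difference of two cosines. One is constant in k and
  gives the term with cos (j alpha_d); the other runs through an arithmetic progression, whose sum
  telescopes. As (d + 2) alpha_d = pi, the sine at the upper end is the negative of the one at the
  lower end, which yields the quotient of sines.\<close>

lemma jackson_autocorrelation:
  assumes "j \<le> d"
  shows "(\<Sum>k\<le>d - j. sin ((real k + 1) * jackson_alpha d) * sin ((real (k + j) + 1) * jackson_alpha d))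
       = (real d + 2) / 2 * jackson_factor j d"
proof -
  define x where "x = jackson_alpha d"
  define S where "S = (\<Sum>k\<le>d - j. cos ((2 * real k + (real j + 2)) * x))"
  have sx: "sin x > 0" using sin_jackson_alpha_pos by (simp add: x_def)
  have "(real d + 2) * x = pi" by (simp add: x_def jackson_alpha_def)
  then have "(2 * real (d - j) + (real j + 2) + 1) * x = 2 * pi - (real j + 1) * x"
    using assms by (simp add: of_nat_diff algebra_simps)
  then have top: "sin ((2 * real (d - j) + (real j + 2) + 1) * x) = - sin ((real j + 1) * x)"
    by (simp only: sin_diff) simp
  have bottom: "(real j + 2 - 1) * x = (real j + 1) * x" by simp
  have solve: "q = - r / p" if "2 * p * q = - 2 * r" "p \<noteq> 0" for p q r :: real
    using that by (simp add: field_simps)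
  have "2 * sin x * S = - 2 * sin ((real j + 1) * x)"
    unfolding S_def sum_cos_arith_progression top bottom by simp
  then have S: "S = - sin ((real j + 1) * x) / sin x"
    by (rule solve) (use sx in simp)
  have "(real d + 2) * (sin ((real j + 1) * x) / ((real d + 2) * sin x)) = sin ((real j + 1) * x) / sin x"
    by simp
  moreover have "(real d + 2) * (1 - (real j + 1) / (real d + 2)) = real (d - j) + 1"
    using assms by (simp add: right_diff_distrib of_nat_diff)
  then have "(real d + 2) * ((1 - (real j + 1) / (real d + 2)) * cos (real j * x))
      = (real (d - j) + 1) * cos (real j * x)"
    by (simp only: mult.assoc[symmetric])
  ultimately have factor: "(real d + 2) * jackson_factor j d
      = sin ((real j + 1) * x) / sin x + (real (d - j) + 1) * cos (real j * x)"
    unfolding jackson_factor_def x_def[symmetric] distrib_left by (simp only:)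
  have "(\<Sum>k\<le>d - j. sin ((real k + 1) * x) * sin ((real (k + j) + 1) * x))
      = (\<Sum>k\<le>d - j. (cos (real j * x) - cos ((2 * real k + (real j + 2)) * x)) / 2)"
  proof (rule sum.cong)
    fix k
    show "sin ((real k + 1) * x) * sin ((real (k + j) + 1) * x)
        = (cos (real j * x) - cos ((2 * real k + (real j + 2)) * x)) / 2"
      using sin_times_sin[of "(real (k + j) + 1) * x" "(real k + 1) * x"]
      by (simp add: algebra_simps)
  qed simp
  also have "\<dots> = ((real (d - j) + 1) * cos (real j * x) - S) / 2"
    unfolding S_def sum_divide_distrib[symmetric] sum_subtractf by simp
  also have "\<dots> = (real d + 2) / 2 * jackson_factor j d"
    using factor unfolding S by simp
  finally show ?thesis by (simp add: x_def)
qed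

lemma jackson_factor_0: "jackson_factor 0 d = 1"
proof -
  have "sin (jackson_alpha d) / ((real d + 2) * sin (jackson_alpha d)) = 1 / (real d + 2)"
    using sin_jackson_alpha_pos[of d] by simp
  then show ?thesis by (simp add: jackson_factor_def)
qed

lemma jackson_factor_1: "jackson_factor 1 d = cos (jackson_alpha d)"
proof -
  have "sin (2 * jackson_alpha d) / ((real d + 2) * sin (jackson_alpha d))
      = 2 / (real d + 2) * cos (jackson_alpha d)"
    unfolding sin_double using sin_jackson_alpha_pos[of d] by simp
  then show ?thesis by (simp add: jackson_factor_def algebra_simps)
qed

text \<open>(1 - cos s)^2 contains no frequency above two, so this is the last factor that the
  moments require in closed form.\<close>

lemma jackson_factor_2:
  "jackson_factor 2 d = cos (2 * jackson_alpha d) + 2 * (sin (jackson_alpha d))\<^sup>2 / (real d + 2)"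
proof -
  define x where "x = jackson_alpha d"
  have sx: "sin x > 0" using sin_jackson_alpha_pos by (simp add: x_def)
  have c2: "cos (2 * x) = 1 - 2 * (sin x)\<^sup>2" by (rule cos_double_sin)
  have "sin (3 * x) = sin (2 * x) * cos x + cos (2 * x) * sin x"
    using sin_add[of "2 * x" x] by simp
  also have "\<dots> = sin x * (2 * (cos x)\<^sup>2 + cos (2 * x))"
    unfolding sin_double by (simp only: power2_eq_square distrib_left mult_ac)
  also have "2 * (cos x)\<^sup>2 + cos (2 * x) = 3 - 4 * (sin x)\<^sup>2"
    unfolding c2 cos_squared_eq by simp
  finally have s3: "sin (3 * x) / ((real d + 2) * sin x) = (3 - 4 * (sin x)\<^sup>2) / (real d + 2)"
    using sx by simp
  have "jackson_factor 2 d = sin (3 * x) / ((real d + 2) * sin x) + (1 - 3 / (real d + 2)) * cos (2 * x)"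
    by (simp add: jackson_factor_def x_def)
  also have "\<dots> = cos (2 * x) + 2 * (sin x)\<^sup>2 / (real d + 2)"
    unfolding s3 c2
    by (simp add: diff_divide_distrib left_diff_distrib right_diff_distrib)
  finally show ?thesis by (simp add: x_def)
qed

text \<open>The off-diagonal terms are grouped by the difference j of their indices. In the
  induction the new row and the new column agree by symmetry and contribute one new term to each
  group.\<close>

lemma sum_square_symmetric:
  fixes f :: "nat \<Rightarrow> nat \<Rightarrow> real"
  assumes "\<And>k l. f k l = f l k"
  shows "(\<Sum>k\<le>d. \<Sum>l\<le>d. f k l) = (\<Sum>k\<le>d. f k k) + 2 * (\<Sum>j=1..d. \<Sum>k\<le>d - j. f k (k + j))"
proof (induction d)
  case (Suc d)
  have "(\<Sum>k\<le>Suc d. \<Sum>l\<le>Suc d. f k l)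
      = (\<Sum>k\<le>d. \<Sum>l\<le>d. f k l) + 2 * (\<Sum>k\<le>d. f k (Suc d)) + f (Suc d) (Suc d)"
  proof -
    have "(\<Sum>l\<le>d. f (Suc d) l) = (\<Sum>k\<le>d. f k (Suc d))" by (intro sum.cong refl assms)
    then show ?thesis by (simp add: sum.distrib)
  qed
  moreover have "(\<Sum>j=1..Suc d. \<Sum>k\<le>Suc d - j. f k (k + j))
      = (\<Sum>j=1..d. \<Sum>k\<le>d - j. f k (k + j)) + (\<Sum>k\<le>d. f k (Suc d))"
  proof -
    have "(\<Sum>j=1..Suc d. \<Sum>k\<le>Suc d - j. f k (k + j))
        = (\<Sum>j=1..d. \<Sum>k\<le>Suc (d - j). f k (k + j)) + f 0 (Suc d)"
      by (simp add: Suc_diff_le)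
    also have "\<dots> = (\<Sum>j=1..d. \<Sum>k\<le>d - j. f k (k + j))
        + ((\<Sum>j=1..d. f (Suc d - j) (Suc d)) + f 0 (Suc d))"
      by (simp add: sum.distrib Suc_diff_le)
    also have "(\<Sum>j=1..d. f (Suc d - j) (Suc d)) = (\<Sum>k=1..d. f k (Suc d))"
      by (rule sum.reindex_bij_witness[of _ "\<lambda>k. Suc d - k" "\<lambda>k. Suc d - k"]) auto
    also have "\<dots> + f 0 (Suc d) = (\<Sum>k\<le>d. f k (Suc d))"
      by (simp add: atMost_atLeast0 sum.atLeast_Suc_atMost)
    finally show ?thesis .
  qed
  ultimately show ?case using Suc by simp
qed simp

text \<open>Up to the factor \<open>d + 2\<close>, the Jackson kernel is the squared modulus of
  \<open>\<Sum>k\<le>d. sin ((k + 1) \<alpha>\<^sub>d) exp (i k s)\<close>.\<close>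

lemma jackson_kernel_nonneg: "jackson_kernel d s \<ge> 0"
proof -
  define a where "a k = sin ((real k + 1) * jackson_alpha d)" for k :: nat
  have corr: "(\<Sum>k\<le>d - j. a k * a (k + j)) = (real d + 2) / 2 * jackson_factor j d" if "j \<le> d" for j
    using jackson_autocorrelation[OF that] by (simp add: a_def)
  have "0 \<le> (\<Sum>k\<le>d. a k * cos (real k * s))\<^sup>2 + (\<Sum>k\<le>d. a k * sin (real k * s))\<^sup>2"
    by simp
  also have "\<dots> = (\<Sum>k\<le>d. \<Sum>l\<le>d. a k * a l * cos ((real k - real l) * s))"
    unfolding power2_eq_square sum_product sum.distrib[symmetric]
    by (intro sum.cong) (simp_all add: left_diff_distrib cos_diff algebra_simps)
  also have "\<dots> = (\<Sum>k\<le>d. a k * a k) + 2 * (\<Sum>j=1..d. \<Sum>k\<le>d - j. a k * a (k + j) * cos (real j * s))"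
  proof (subst sum_square_symmetric)
    show "a k * a l * cos ((real k - real l) * s) = a l * a k * cos ((real l - real k) * s)" for k l
    proof -
      have "(real l - real k) * s = - ((real k - real l) * s)" by (simp add: algebra_simps)
      then show ?thesis by (simp only: cos_minus mult.commute)
    qed
  qed simp
  also have "\<dots> = (real d + 2) * jackson_kernel d s"
  proof -
    have "(\<Sum>j=1..d. \<Sum>k\<le>d - j. a k * a (k + j) * cos (real j * s))
        = (\<Sum>j=1..d. (real d + 2) / 2 * (jackson_factor j d * cos (real j * s)))"
      unfolding sum_distrib_right[symmetric]
      by (rule sum.cong) (simp_all add: corr)
    also have "\<dots> = (real d + 2) / 2 * (\<Sum>j=1..d. jackson_factor j d * cos (real j * s))"
      by (simp only: sum_distrib_left)
    finally have off_diagonal: "(\<Sum>j=1..d. \<Sum>k\<le>d - j. a k * a (k + j) * cos (real j * s)) = \<dots>" .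
    have diagonal: "(\<Sum>k\<le>d. a k * a k) = (real d + 2) / 2"
      using corr[of 0] by (simp add: jackson_factor_0)
    show ?thesis
      unfolding off_diagonal diagonal jackson_kernel_def by (simp add: distrib_left)
  qed
  finally show ?thesis by (simp add: zero_le_mult_iff)
qed

lemma jackson_kernel_even: "jackson_kernel d (- s) = jackson_kernel d s"
  by (simp add: jackson_kernel_def)

lemma jackson_kernel_periodic: "jackson_kernel d (2 * pi - s) = jackson_kernel d s"
proof -
  have "cos (real j * (2 * pi - s)) = cos (real j * s)" for j
  proof -
    have "real j * (2 * pi - s) = 2 * pi * real j - real j * s"
      by (simp add: algebra_simps)
    moreover have "cos (2 * pi * real j) = 1" "sin (2 * pi * real j) = 0"
      using sin_npi2[of "2 * j"] cos_npi2[of "2 * j"] by (simp_all add: mult_ac)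
    ultimately show ?thesis by (simp add: cos_diff)
  qed
  then show ?thesis by (simp add: jackson_kernel_def)
qed

lemma continuous_on_jackson_kernel [continuous_intros]:
  fixes f :: "real \<Rightarrow> real"
  shows "continuous_on S f \<Longrightarrow> continuous_on S (\<lambda>x. jackson_kernel d (f x))"
  unfolding jackson_kernel_def by (auto intro!: continuous_intros)

section \<open>The kernel folded onto [0, pi] and its moments\<close>

lemma jackson_kernel_folded:
  "jackson_kernel d (u - \<theta>) + jackson_kernel d (u + \<theta>)
     = 1 + 2 * (\<Sum>j=1..d. jackson_factor j d * cos (real j * \<theta>) * cos (real j * u))"
proof -
  have "cos (real j * (u - \<theta>)) + cos (real j * (u + \<theta>)) = 2 * cos (real j * \<theta>) * cos (real j * u)" for j
    by (simp add: distrib_left right_diff_distrib cos_add cos_diff)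
  then have "jackson_factor j d * cos (real j * (u - \<theta>)) + jackson_factor j d * cos (real j * (u + \<theta>))
     = 2 * (jackson_factor j d * cos (real j * \<theta>) * cos (real j * u))" for j
    by (metis (no_types, lifting) distrib_left mult.assoc mult.left_commute)
  then show ?thesis
    by (simp add: jackson_kernel_def sum.distrib[symmetric] sum_distrib_left)
qed

text \<open>Since cosine is even, the two terms together run once through the full period from - pi
  - theta to pi - theta. The frequency is an integer because products of cosines produce differences
  j - i of either sign.\<close>

lemma has_integral_cos_folded:
  fixes m :: int
  assumes "m \<noteq> 0"
  shows "((\<lambda>u. cos (of_int m * (u - \<theta>)) + cos (of_int m * (u + \<theta>))) has_integral 0) {0..pi}"
proof -
  define F where "F u = (sin (of_int m * (u - \<theta>)) + sin (of_int m * (u + \<theta>))) / of_int m" for u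
  have "((\<lambda>u. cos (of_int m * (u - \<theta>)) + cos (of_int m * (u + \<theta>))) has_integral F pi - F 0) {0..pi}"
    by (rule fundamental_theorem_of_calculus)
       (use assms in \<open>auto intro!: derivative_eq_intros
          simp: F_def simp flip: has_real_derivative_iff_has_vector_derivative simp: field_simps\<close>)
  moreover have "sin (of_int m * pi) = 0"
    using sin_zero_iff_int2 by blast
  then have "F pi - F 0 = 0"
    by (simp add: F_def distrib_left right_diff_distrib sin_add sin_diff)
  ultimately show ?thesis by simp
qed

lemma has_integral_cos_cos_folded:
  fixes i j :: nat
  assumes "i > 0"
  shows "((\<lambda>u. cos (real j * (u - \<theta>)) * cos (real i * (u - \<theta>))
             + cos (real j * (u + \<theta>)) * cos (real i * (u + \<theta>)))
          has_integral (if j = i then pi else 0)) {0..pi}"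
proof -
  define C where "C m u = cos (of_int m * (u - \<theta>)) + cos (of_int m * (u + \<theta>))" for m :: int and u
  have prod: "cos (real j * (u - \<theta>)) * cos (real i * (u - \<theta>))
      + cos (real j * (u + \<theta>)) * cos (real i * (u + \<theta>))
      = 1 / 2 * (C (int j - int i) u + C (int j + int i) u)" for u
    unfolding C_def cos_times_cos by (simp add: algebra_simps add_divide_distrib)
  have "(C (int j + int i) has_integral 0) {0..pi}"
    using has_integral_cos_folded[of "int j + int i" \<theta>] assms by (simp add: C_def[abs_def])
  moreover have "(C (int j - int i) has_integral (if j = i then 2 * pi else 0)) {0..pi}"
  proof (cases "j = i")
    case True
    then show ?thesis
      using has_integral_const_real[of "2::real" 0 pi] by (simp add: C_def[abs_def] mult.commute)
  next
    case False
    then show ?thesis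
      using has_integral_cos_folded[of "int j - int i" \<theta>] by (simp add: C_def[abs_def])
  qed
  ultimately have "((\<lambda>u. 1 / 2 * (C (int j - int i) u + C (int j + int i) u))
      has_integral 1 / 2 * ((if j = i then 2 * pi else 0) + 0)) {0..pi}"
    by (intro has_integral_mult_right has_integral_add)
  then show ?thesis unfolding prod by (simp split: if_splits)
qed

lemma has_integral_jackson_kernel_folded:
  "((\<lambda>u. jackson_kernel d (u - \<theta>) + jackson_kernel d (u + \<theta>)) has_integral pi) {0..pi}"
proof -
  have "((\<lambda>u. (1 / 2 + 1 / 2) + (\<Sum>j=1..d. jackson_factor j d *
           (cos (of_int (int j) * (u - \<theta>)) + cos (of_int (int j) * (u + \<theta>)))))
         has_integral pi + (\<Sum>j=1..d. jackson_factor j d * 0)) {0..pi}"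
    using has_integral_const_real[of "1::real" 0 pi]
    by (intro has_integral_add has_integral_sum has_integral_mult_right has_integral_cos_folded) auto
  moreover have "jackson_kernel d (u - \<theta>) + jackson_kernel d (u + \<theta>)
      = (1 / 2 + 1 / 2) + (\<Sum>j=1..d. jackson_factor j d *
           (cos (of_int (int j) * (u - \<theta>)) + cos (of_int (int j) * (u + \<theta>))))" for u
    unfolding jackson_kernel_def of_int_of_nat_eq distrib_left[of "jackson_factor _ d"] sum.distrib
    by linarith
  ultimately show ?thesis
    by (simp only: mult_zero_right sum.neutral_const add_0_right)
qed

lemma has_integral_cos_jackson_kernel_folded:
  assumes "i > 0" "i \<le> d"
  shows "((\<lambda>u. cos (real i * (u - \<theta>)) * jackson_kernel d (u - \<theta>)
             + cos (real i * (u + \<theta>)) * jackson_kernel d (u + \<theta>))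
          has_integral pi * jackson_factor i d) {0..pi}"
proof -
  have "((\<lambda>u. 1 / 2 * (cos (of_int (int i) * (u - \<theta>)) + cos (of_int (int i) * (u + \<theta>)))
          + (\<Sum>j=1..d. jackson_factor j d *
               (cos (real j * (u - \<theta>)) * cos (real i * (u - \<theta>))
                + cos (real j * (u + \<theta>)) * cos (real i * (u + \<theta>)))))
         has_integral 1 / 2 * 0 + (\<Sum>j=1..d. jackson_factor j d * (if j = i then pi else 0))) {0..pi}"
    using assms
    by (intro has_integral_add has_integral_sum has_integral_mult_right has_integral_cos_folded
        has_integral_cos_cos_folded) auto
  moreover have "(\<Sum>j=1..d. jackson_factor j d * (if j = i then pi else 0)) = pi * jackson_factor i d"
    using assms by (simp add: if_distrib cong: if_cong)
  moreover have "cos (real i * (u - \<theta>)) * jackson_kernel d (u - \<theta>)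
        + cos (real i * (u + \<theta>)) * jackson_kernel d (u + \<theta>)
      = 1 / 2 * (cos (of_int (int i) * (u - \<theta>)) + cos (of_int (int i) * (u + \<theta>)))
          + (\<Sum>j=1..d. jackson_factor j d *
               (cos (real j * (u - \<theta>)) * cos (real i * (u - \<theta>))
                + cos (real j * (u + \<theta>)) * cos (real i * (u + \<theta>))))" for u
  proof -
    have split: "x * (1 / 2 + X) + y * (1 / 2 + Y) = 1 / 2 * (x + y) + (x * X + y * Y)" for x y X Y :: real
      by (simp add: distrib_left)
    have summand: "x * (\<rho> * X) + y * (\<rho> * Y) = \<rho> * (X * x + Y * y)" for x y X Y \<rho> :: real
      by (simp add: distrib_left)
    show ?thesis
      unfolding jackson_kernel_def of_int_of_nat_eq split
      unfolding sum_distrib_left sum.distrib[symmetric] summand ..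
  qed
  ultimately show ?thesis by (simp only: mult_zero_right add_0_left)
qed

lemma has_integral_jackson_second_moment:
  assumes "d \<ge> 1"
  shows "((\<lambda>u. (1 - cos (u - \<theta>)) * jackson_kernel d (u - \<theta>)
             + (1 - cos (u + \<theta>)) * jackson_kernel d (u + \<theta>))
          has_integral pi * (1 - cos (jackson_alpha d))) {0..pi}"
  using has_integral_diff[OF has_integral_jackson_kernel_folded[of d \<theta>]
      has_integral_cos_jackson_kernel_folded[of 1 d \<theta>]] assms
  by (simp add: jackson_factor_1[simplified] algebra_simps)

lemma has_integral_jackson_fourth_moment:
  assumes "d \<ge> 2"
  shows "((\<lambda>u. (1 - cos (u - \<theta>))\<^sup>2 * jackson_kernel d (u - \<theta>)
             + (1 - cos (u + \<theta>))\<^sup>2 * jackson_kernel d (u + \<theta>))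
          has_integral pi * ((1 - cos (jackson_alpha d))\<^sup>2
             + (sin (jackson_alpha d))\<^sup>2 / (real d + 2))) {0..pi}"
proof -
  define K where "K = jackson_kernel d"
  \<comment> \<open>Integration against the kernel replaces the frequencies 0, 1, 2 by 1, rho_1,
    rho_2, up to the factor pi; \<open>d \<ge> 2\<close> ensures that both factors occur in the
    kernel. The claimed value is 3/2 - 2 rho_1 + rho_2 / 2.\<close>
  have sq: "(1 - cos s)\<^sup>2 = 3 / 2 - 2 * cos (real 1 * s) + 1 / 2 * cos (real 2 * s)" for s :: real
    using cos_double_cos[of s] by (simp add: power2_eq_square algebra_simps)
  have "((\<lambda>u. 3 / 2 * (K (u - \<theta>) + K (u + \<theta>))
          - 2 * (cos (real 1 * (u - \<theta>)) * K (u - \<theta>) + cos (real 1 * (u + \<theta>)) * K (u + \<theta>))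
          + 1 / 2 * (cos (real 2 * (u - \<theta>)) * K (u - \<theta>) + cos (real 2 * (u + \<theta>)) * K (u + \<theta>)))
         has_integral 3 / 2 * pi - 2 * (pi * jackson_factor 1 d) + 1 / 2 * (pi * jackson_factor 2 d))
        {0..pi}"
    unfolding K_def using assms
    by (intro has_integral_add has_integral_diff has_integral_mult_right
        has_integral_jackson_kernel_folded has_integral_cos_jackson_kernel_folded) auto
  also have "3 / 2 * pi - 2 * (pi * jackson_factor 1 d) + 1 / 2 * (pi * jackson_factor 2 d)
      = pi * ((1 - cos (jackson_alpha d))\<^sup>2 + (sin (jackson_alpha d))\<^sup>2 / (real d + 2))"
    unfolding jackson_factor_1 jackson_factor_2 cos_double_cos
    by (simp add: power2_eq_square algebra_simps)
  finally show ?thesis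
    unfolding sq K_def by (simp only: algebra_simps)
qed

lemma jackson_second_moment_le:
  "1 - cos (jackson_alpha d) \<le> pi\<^sup>2 / (2 * (real d + 2)\<^sup>2)"
  using one_minus_cos_le[of "jackson_alpha d"] by (simp add: jackson_alpha_def power_divide)

text \<open>The sine term dominates, with order (d + 2)^-3. The square is of order (d + 2)^-4 and
  fits under the same bound because pi^2 <= 16 <= 4 (d + 2); hence the factor 2.\<close>

lemma jackson_fourth_moment_le:
  assumes "d \<ge> 2"
  shows "(1 - cos (jackson_alpha d))\<^sup>2 + (sin (jackson_alpha d))\<^sup>2 / (real d + 2)
    \<le> 2 * pi\<^sup>2 / (real d + 2) ^ 3"
proof -
  define D where "D = real d + 2"
  have D: "D \<ge> 4" using assms by (simp add: D_def)
  have "(1 - cos (jackson_alpha d))\<^sup>2 \<le> (pi\<^sup>2 / (2 * D\<^sup>2))\<^sup>2"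
    unfolding D_def by (rule power_mono[OF jackson_second_moment_le]) simp
  also have "\<dots> = pi\<^sup>2 * (pi\<^sup>2 / (4 * D)) / D ^ 3"
    using D by (simp add: power2_eq_square power3_eq_cube field_simps)
  also have "\<dots> \<le> pi\<^sup>2 * 1 / D ^ 3"
  proof (intro divide_right_mono mult_left_mono)
    have "pi\<^sup>2 \<le> 4\<^sup>2" using pi_less_4 by (intro power_mono) auto
    then show "pi\<^sup>2 / (4 * D) \<le> 1" using D by simp
  qed (use D in auto)
  finally have "(1 - cos (jackson_alpha d))\<^sup>2 \<le> pi\<^sup>2 / D ^ 3" by simp
  moreover have "(sin (jackson_alpha d))\<^sup>2 \<le> (pi / D)\<^sup>2"
    using abs_sin_x_le_abs_x[of "jackson_alpha d"]
    by (simp only: abs_le_square_iff jackson_alpha_def D_def)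
  then have "(sin (jackson_alpha d))\<^sup>2 / D \<le> (pi / D)\<^sup>2 / D"
    using D by (simp add: divide_right_mono)
  moreover have "(pi / D)\<^sup>2 / D = pi\<^sup>2 / D ^ 3"
    using D by (simp add: power2_eq_square power3_eq_cube)
  ultimately show ?thesis by (simp add: D_def)
qed

section \<open>Localisation of folded convolutions\<close>

text \<open>At a jump this shows that one side of the window carries half of the kernel, which
  matches the value 1 / 2 of the step function.\<close>

lemma integral_even_about:
  fixes g :: "real \<Rightarrow> real"
  assumes "r \<ge> 0" "continuous_on UNIV g" and even: "\<And>s. g (- s) = g s"
  shows "integral {x - r..x + r} (\<lambda>u. g (u - x)) = 2 * integral {x - r..x} (\<lambda>u. g (u - x))"
proof -
  have shift: "integral {x + s..x + t} (\<lambda>u. g (u - x)) = integral {s..t} g" for s t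
    using integral_shift_real_ivl[of "x + s" x "x + t" "\<lambda>u. g (u - x)"] by simp
  have "continuous_on {- r..r} g" using assms(2) by (rule continuous_on_subset) simp
  then have "integral {- r..r} g = integral {- r..0} g + integral {0..r} g"
    using assms(1) Henstock_Kurzweil_Integration.integral_combine[of "- r" 0 r g] by (simp add: integrable_continuous_real)
  moreover have "integral {0..r} g = integral {- r..0} g"
    using Henstock_Kurzweil_Integration.integral_reflect_real[of r 0 g] by (simp add: even)
  ultimately show ?thesis
    using shift[of "- r" r] shift[of "- r" 0] by simp
qed

lemma integral_odd_about:
  fixes g :: "real \<Rightarrow> real"
  assumes odd: "\<And>s. g (- s) = - g s"
  shows "integral {x - r..x + r} (\<lambda>u. g (u - x)) = 0"
proof -
  have "integral {x - r..x + r} (\<lambda>u. g (u - x)) = integral {- r..r} g"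
    using integral_shift_real_ivl[of "x - r" x "x + r" "\<lambda>u. g (u - x)"] by simp
  moreover have "integral {- r..r} g = - integral {- r..r} g"
    using Henstock_Kurzweil_Integration.integral_reflect_real[of r "- r" g] by (simp add: odd)
  ultimately show ?thesis by simp
qed

text \<open>As in Chebyshev's inequality, away from 0 modulo 2 pi the constant 1 is replaced by a
  multiple of (1 - cos s)^2, whose mean is known. Arguments beyond pi occur as u + theta and are
  first reduced to [-pi, pi].\<close>

lemma one_le_far_weight:
  assumes "\<Delta> > 0" "\<Delta> \<le> \<bar>s\<bar>" "\<bar>s\<bar> \<le> 2 * pi - \<Delta>"
  shows "1 \<le> pi ^ 4 / (4 * \<Delta> ^ 4) * (1 - cos s)\<^sup>2"
proof -
  have "\<exists>t. cos t = cos s \<and> \<Delta> \<le> \<bar>t\<bar> \<and> \<bar>t\<bar> \<le> pi"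
  proof (cases "\<bar>s\<bar> \<le> pi")
    case False
    have "cos (2 * pi - \<bar>s\<bar>) = cos s" by (simp add: cos_diff)
    then show ?thesis using False assms by (intro exI[of _ "2 * pi - \<bar>s\<bar>"]) auto
  qed (use assms in auto)
  then obtain t where t: "cos t = cos s" "\<Delta> \<le> \<bar>t\<bar>" "\<bar>t\<bar> \<le> pi" by blast
  have "\<Delta>\<^sup>2 \<le> \<bar>t\<bar>\<^sup>2" using t assms by (intro power_mono) auto
  also have "\<dots> \<le> pi\<^sup>2 / 2 * (1 - cos t)" using square_le_one_minus_cos[OF t(3)] by simp
  finally have "(\<Delta>\<^sup>2)\<^sup>2 \<le> (pi\<^sup>2 / 2 * (1 - cos t))\<^sup>2" by (rule power_mono) simp
  then have "\<Delta> ^ 4 \<le> pi ^ 4 / 4 * (1 - cos s)\<^sup>2"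
    by (simp add: t power_mult_distrib power_divide flip: power_mult)
  then show ?thesis using assms(1) by (simp add: field_simps)
qed

text \<open>The convolution over the circle of an even function with an even kernel \<open>K\<close> is, at \<open>\<theta>\<close>, an
  integral over \<open>[0, pi]\<close> against \<open>K (u - \<theta>) + K (u + \<theta>)\<close>.\<close>

locale even_kernel =
  fixes K :: "real \<Rightarrow> real" and m2 m4 :: real
  assumes continuous: "continuous_on UNIV K"
    and nonneg: "K s \<ge> 0"
    and even: "K (- s) = K s"
    and periodic: "K (2 * pi - s) = K s"
    and mass: "((\<lambda>u. K (u - \<theta>) + K (u + \<theta>)) has_integral 1) {0..pi}"
    and second_moment: "((\<lambda>u. (1 - cos (u - \<theta>)) * K (u - \<theta>) + (1 - cos (u + \<theta>)) * K (u + \<theta>))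
          has_integral m2) {0..pi}"
    and fourth_moment: "((\<lambda>u. (1 - cos (u - \<theta>))\<^sup>2 * K (u - \<theta>) + (1 - cos (u + \<theta>))\<^sup>2 * K (u + \<theta>))
          has_integral m4) {0..pi}"
begin

definition folded :: "real \<Rightarrow> real \<Rightarrow> real" where
  "folded \<theta> u = K (u - \<theta>) + K (u + \<theta>)"

lemma continuous_on_K [continuous_intros]:
  "continuous_on S f \<Longrightarrow> continuous_on S (\<lambda>x. K (f x))"
  using continuous_on_compose2[OF continuous] by blast

lemma continuous_on_folded [continuous_intros]:
  "continuous_on S (folded \<theta>)"
  unfolding folded_def by (intro continuous_intros)

lemma folded_nonneg: "folded \<theta> u \<ge> 0"
  by (simp add: folded_def nonneg)

lemma folded_reflect: "folded (pi - \<theta>) (pi - u) = folded \<theta> u"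
  using even[of "u - \<theta>"] periodic[of "u + \<theta>"] by (simp add: folded_def algebra_simps)

lemma outside_bound:
  assumes "\<theta> \<in> {0..pi}" "\<Delta> > 0" "0 \<le> \<beta>" "\<alpha> \<le> pi" "B \<ge> 0"
    and q: "continuous_on {\<beta>..\<alpha>} q" "\<And>u. u \<in> {\<beta>..\<alpha>} \<Longrightarrow> \<bar>q u\<bar> \<le> B"
    and far: "\<And>u. u \<in> {\<beta>..\<alpha>} \<Longrightarrow> \<Delta> \<le> \<bar>u - \<theta>\<bar>"
  shows "\<bar>integral {\<beta>..\<alpha>} (\<lambda>u. q u * folded \<theta> u)\<bar> \<le> B * (pi ^ 4 / (4 * \<Delta> ^ 4) * m4)"
proof -
  define C where "C = pi ^ 4 / (4 * \<Delta> ^ 4)"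
  define E where "E u = (1 - cos (u - \<theta>))\<^sup>2 * K (u - \<theta>) + (1 - cos (u + \<theta>))\<^sup>2 * K (u + \<theta>)" for u
  have E: "(E has_integral m4) {0..pi}" unfolding E_def by (rule fourth_moment)
  have C: "C \<ge> 0" by (simp add: C_def)
  have cont: "continuous_on S E" for S unfolding E_def by (intro continuous_intros)
  have "norm (integral {\<beta>..\<alpha>} (\<lambda>u. q u * folded \<theta> u)) \<le> integral {\<beta>..\<alpha>} (\<lambda>u. B * (C * E u))"
  proof (rule integral_norm_bound_integral)
    fix u assume u: "u \<in> {\<beta>..\<alpha>}"
    \<comment> \<open>For u and theta in [0, pi], both u + theta and 2 pi - (u + theta) are at least
      |u - theta|, so the mirror image is as far away as the direct term.\<close>
    have "1 \<le> C * (1 - cos (u - \<theta>))\<^sup>2" "1 \<le> C * (1 - cos (u + \<theta>))\<^sup>2"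
      unfolding C_def by (rule one_le_far_weight; use assms u far[OF u] in force)+
    then have "1 * K (u - \<theta>) \<le> C * (1 - cos (u - \<theta>))\<^sup>2 * K (u - \<theta>)"
      "1 * K (u + \<theta>) \<le> C * (1 - cos (u + \<theta>))\<^sup>2 * K (u + \<theta>)"
      by (intro mult_right_mono nonneg; simp)+
    then have "folded \<theta> u \<le> C * E u" by (simp add: folded_def E_def algebra_simps)
    then show "norm (q u * folded \<theta> u) \<le> B * (C * E u)"
      using q(2)[OF u] assms(5) folded_nonneg by (simp add: abs_mult mult_mono)
  qed (auto intro!: integrable_continuous_real continuous_intros q cont)
  also have "\<dots> \<le> integral {0..pi} (\<lambda>u. B * (C * E u))"
    using assms nonneg C
    by (intro integral_subset_le integrable_continuous_real continuous_intros cont) (auto simp: E_def)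
  also have "\<dots> = B * (C * m4)" using E by (simp add: integral_unique)
  finally show ?thesis by (simp add: C_def)
qed

text \<open>The kernel has mass 1, so the error is the integral of the deviation \<open>D\<close>
  against the folded kernel. The fourth moment pays for everything outside the window, and also for
  K (u + theta) everywhere, since a window inside [0, pi] keeps u + theta between Delta and 2 pi -
  Delta. Only the direct term in the window remains. The reference value \<open>c\<close> is free in
  order to serve points of continuity as well as jumps, where it is half the one-sided
  value.\<close>

lemma localize:
  assumes "0 \<le> \<theta> - \<Delta>" "\<theta> + \<Delta> \<le> pi" "\<Delta> > 0" "0 \<le> \<beta>" "\<alpha> \<le> pi" "E0 \<ge> 0"
    and q: "continuous_on {\<beta>..\<alpha>} q"
    and D: "\<And>u. D u = (if u \<in> {\<beta>..\<alpha>} then q u else 0) - c"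
    and D_le: "\<And>u. u \<in> {0..pi} \<Longrightarrow> \<bar>D u\<bar> \<le> E0"
  shows "\<bar>integral {\<beta>..\<alpha>} (\<lambda>u. q u * folded \<theta> u) - c
            - integral {\<theta> - \<Delta>..\<theta> + \<Delta>} (\<lambda>u. D u * K (u - \<theta>))\<bar>
         \<le> E0 * (pi ^ 4 / (4 * \<Delta> ^ 4) * m4)"
proof -
  define C where "C = pi ^ 4 / (4 * \<Delta> ^ 4)"
  define E where "E u = (1 - cos (u - \<theta>))\<^sup>2 * K (u - \<theta>) + (1 - cos (u + \<theta>))\<^sup>2 * K (u + \<theta>)" for u
  define I where "I = {\<theta> - \<Delta>..\<theta> + \<Delta>}"
  have E: "(E has_integral m4) {0..pi}" unfolding E_def by (rule fourth_moment)
  have C: "C \<ge> 0" by (simp add: C_def)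
  have sub: "{\<beta>..\<alpha>} \<inter> {0..pi} = {\<beta>..\<alpha>}" "I \<inter> {0..pi} = I"
    using assms by (auto simp: I_def)
  have D_eq: "D u * f u = (if u \<in> {\<beta>..\<alpha>} then q u * f u else 0) - c * f u" for f u
    by (simp add: D left_diff_distrib)
  have D_int: "(\<lambda>u. D u * f u) integrable_on {0..pi}" if f: "continuous_on {0..pi} f" for f
  proof -
    have "continuous_on {\<beta>..\<alpha>} f" using f assms by (rule_tac continuous_on_subset) auto
    then have 1: "(\<lambda>u. if u \<in> {\<beta>..\<alpha>} then q u * f u else 0) integrable_on {0..pi}"
      unfolding integrable_restrict_Int sub
      by (intro integrable_continuous_real continuous_intros q)
    have 2: "(\<lambda>u. c * f u) integrable_on {0..pi}"
      by (intro integrable_continuous_real continuous_intros f)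
    show ?thesis unfolding D_eq by (rule integrable_diff[OF 1 2])
  qed
  have whole: "integral {0..pi} (\<lambda>u. D u * folded \<theta> u) = integral {\<beta>..\<alpha>} (\<lambda>u. q u * folded \<theta> u) - c"
  proof -
    have "((\<lambda>u. if u \<in> {\<beta>..\<alpha>} then q u * folded \<theta> u else 0) has_integral
        integral {\<beta>..\<alpha>} (\<lambda>u. q u * folded \<theta> u)) {0..pi}"
      unfolding has_integral_restrict_Int sub
      by (intro integrable_integral integrable_continuous_real continuous_intros q)
    moreover have "((\<lambda>u. c * folded \<theta> u) has_integral c * 1) {0..pi}"
      unfolding folded_def by (intro has_integral_mult_right mass)
    ultimately have "((\<lambda>u. D u * folded \<theta> u) has_integral
        integral {\<beta>..\<alpha>} (\<lambda>u. q u * folded \<theta> u) - c * 1) {0..pi}"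
      unfolding D_eq by (rule has_integral_diff)
    then show ?thesis by (simp add: integral_unique)
  qed
  have DK: "(\<lambda>u. D u * K (u - \<theta>)) integrable_on I"
  proof -
    have "(\<lambda>u. D u * K (u - \<theta>)) integrable_on {0..pi}"
      by (rule D_int) (intro continuous_intros)
    then show ?thesis
      unfolding I_def by (rule integrable_subinterval_real) (use assms in auto)
  qed
  define G where "G u = D u * folded \<theta> u - (if u \<in> I then D u * K (u - \<theta>) else 0)" for u
  have G: "G integrable_on {0..pi}"
    "integral {0..pi} G = integral {0..pi} (\<lambda>u. D u * folded \<theta> u) - integral I (\<lambda>u. D u * K (u - \<theta>))"
  proof -
    have 1: "(\<lambda>u. D u * folded \<theta> u) integrable_on {0..pi}"
      by (rule D_int[OF continuous_on_folded])
    have 2: "(\<lambda>u. if u \<in> I then D u * K (u - \<theta>) else 0) integrable_on {0..pi}"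
      unfolding integrable_restrict_Int sub by (rule DK)
    show "G integrable_on {0..pi}" unfolding G_def by (rule integrable_diff[OF 1 2])
    show "integral {0..pi} G = integral {0..pi} (\<lambda>u. D u * folded \<theta> u) - integral I (\<lambda>u. D u * K (u - \<theta>))"
      unfolding G_def integral_diff[OF 1 2] integral_restrict_Int sub ..
  qed
  have "norm (integral {0..pi} G) \<le> integral {0..pi} (\<lambda>u. E0 * (C * E u))"
  proof (rule integral_norm_bound_integral[OF G(1)])
    show "(\<lambda>u. E0 * (C * E u)) integrable_on {0..pi}"
      using E by (intro integrable_on_mult_right) auto
    fix u assume u: "u \<in> {0..pi}"
    have "1 \<le> C * (1 - cos (u + \<theta>))\<^sup>2"
      unfolding C_def using assms u by (intro one_le_far_weight) auto
    then have R: "1 * K (u + \<theta>) \<le> C * (1 - cos (u + \<theta>))\<^sup>2 * K (u + \<theta>)"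
      by (intro mult_right_mono nonneg)
    define W where "W = (if u \<in> I then 0 else K (u - \<theta>)) + K (u + \<theta>)"
    have P: "(if u \<in> I then 0 else K (u - \<theta>)) \<le> C * (1 - cos (u - \<theta>))\<^sup>2 * K (u - \<theta>)"
    proof (cases "u \<in> I")
      case True
      then show ?thesis using C nonneg by simp
    next
      case False
      then have "1 \<le> C * (1 - cos (u - \<theta>))\<^sup>2"
        unfolding C_def using assms u by (intro one_le_far_weight) (auto simp: I_def)
      then have "1 * K (u - \<theta>) \<le> C * (1 - cos (u - \<theta>))\<^sup>2 * K (u - \<theta>)"
        by (intro mult_right_mono nonneg)
      with False show ?thesis by simp
    qed
    have "W \<le> C * E u" using P R by (simp add: W_def E_def distrib_left mult.assoc)
    moreover have "W \<ge> 0" by (simp add: W_def nonneg)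
    moreover have "G u = D u * W" by (simp add: G_def W_def folded_def distrib_left)
    ultimately show "norm (G u) \<le> E0 * (C * E u)"
      using D_le[OF u] assms(6) by (simp add: abs_mult mult_mono)
  qed
  also have "\<dots> = E0 * (C * m4)" using E by (simp add: integral_unique)
  finally show ?thesis by (simp add: G whole C_def I_def)
qed

lemma central_second_moment_le:
  assumes "0 \<le> \<theta> - \<Delta>" "\<theta> + \<Delta> \<le> pi" "\<Delta> > 0"
  shows "integral {\<theta> - \<Delta>..\<theta> + \<Delta>} (\<lambda>u. (u - \<theta>)\<^sup>2 * K (u - \<theta>)) \<le> pi\<^sup>2 / 2 * m2"
proof -
  define E where "E u = (1 - cos (u - \<theta>)) * K (u - \<theta>) + (1 - cos (u + \<theta>)) * K (u + \<theta>)" for u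
  have E: "(E has_integral m2) {0..pi}" unfolding E_def by (rule second_moment)
  have cont: "continuous_on S E" for S unfolding E_def by (intro continuous_intros)
  have "integral {\<theta> - \<Delta>..\<theta> + \<Delta>} (\<lambda>u. (u - \<theta>)\<^sup>2 * K (u - \<theta>))
      \<le> integral {\<theta> - \<Delta>..\<theta> + \<Delta>} (\<lambda>u. pi\<^sup>2 / 2 * E u)"
  proof (rule integral_le)
    fix u assume "u \<in> {\<theta> - \<Delta>..\<theta> + \<Delta>}"
    then have "\<bar>u - \<theta>\<bar> \<le> pi" using assms by auto
    then have "(u - \<theta>)\<^sup>2 * K (u - \<theta>) \<le> pi\<^sup>2 / 2 * (1 - cos (u - \<theta>)) * K (u - \<theta>)"
      by (intro mult_right_mono square_le_one_minus_cos nonneg)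
    also have "\<dots> \<le> pi\<^sup>2 / 2 * E u"
      unfolding E_def mult.assoc using nonneg by (intro mult_left_mono) auto
    finally show "(u - \<theta>)\<^sup>2 * K (u - \<theta>) \<le> pi\<^sup>2 / 2 * E u" .
  qed (auto intro!: integrable_continuous_real continuous_intros cont)
  also have "\<dots> \<le> integral {0..pi} (\<lambda>u. pi\<^sup>2 / 2 * E u)"
    using assms nonneg
    by (intro integral_subset_le integrable_continuous_real continuous_intros cont) (auto simp: E_def)
  also have "\<dots> = pi\<^sup>2 / 2 * m2" using E by (simp add: integral_unique)
  finally show ?thesis .
qed

lemma central_mass_le:
  assumes "0 \<le> \<theta> - \<Delta>" "\<theta> + \<Delta> \<le> pi"
  shows "integral {\<theta> - \<Delta>..\<theta> + \<Delta>} (\<lambda>u. K (u - \<theta>)) \<le> 1"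
proof -
  have "integral {\<theta> - \<Delta>..\<theta> + \<Delta>} (\<lambda>u. K (u - \<theta>)) \<le> integral {\<theta> - \<Delta>..\<theta> + \<Delta>} (folded \<theta>)"
    by (intro integral_le integrable_continuous_real continuous_intros) (simp add: folded_def nonneg)
  also have "\<dots> \<le> integral {0..pi} (folded \<theta>)"
    using assms by (intro integral_subset_le integrable_continuous_real continuous_intros)
      (auto simp: folded_nonneg)
  also have "\<dots> = 1"
    using integral_unique[OF mass[of \<theta>]] by (simp add: folded_def[abs_def])
  finally show ?thesis .
qed

lemma interior_bound:
  assumes "\<Delta> > 0" "\<beta> \<le> \<theta> - \<Delta>" "\<theta> + \<Delta> \<le> \<alpha>" "0 \<le> \<beta>" "\<alpha> \<le> pi"
    and q': "\<And>u. (q has_real_derivative q' u) (at u)"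
    and q'': "\<And>u. (q' has_real_derivative q'' u) (at u)"
    and B: "\<And>u. u \<in> {\<beta>..\<alpha>} \<Longrightarrow> \<bar>q u\<bar> \<le> B" and B2: "\<And>u. u \<in> {\<beta>..\<alpha>} \<Longrightarrow> \<bar>q'' u\<bar> \<le> B2"
  shows "\<bar>integral {\<beta>..\<alpha>} (\<lambda>u. q u * folded \<theta> u) - q \<theta>\<bar>
    \<le> 2 * B * (pi ^ 4 / (4 * \<Delta> ^ 4) * m4) + B2 / 2 * (pi\<^sup>2 / 2 * m2)"
proof -
  define I where "I = {\<theta> - \<Delta>..\<theta> + \<Delta>}"
  have I: "I \<subseteq> {\<beta>..\<alpha>}" "\<theta> \<in> {\<beta>..\<alpha>}" using assms by (auto simp: I_def)
  have B0: "B \<ge> 0" using B[OF I(2)] by linarith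
  have B20: "B2 \<ge> 0" using B2[OF I(2)] by linarith
  have cont: "continuous_on S q" for S
    using q' by (meson DERIV_isCont continuous_at_imp_continuous_on)
  define D where "D u = (if u \<in> {\<beta>..\<alpha>} then q u else 0) - q \<theta>" for u
  have D_le: "\<bar>D u\<bar> \<le> 2 * B" for u
    using B[of u] B[OF I(2)] B0 by (auto simp: D_def)
  have main: "\<bar>integral {\<beta>..\<alpha>} (\<lambda>u. q u * folded \<theta> u) - q \<theta> - integral I (\<lambda>u. D u * K (u - \<theta>))\<bar>
      \<le> 2 * B * (pi ^ 4 / (4 * \<Delta> ^ 4) * m4)"
    unfolding I_def by (rule localize[OF _ _ _ _ _ _ cont D_def D_le]) (use assms B0 in auto)
  have taylor: "\<bar>q u - q \<theta> - q' \<theta> * (u - \<theta>)\<bar> \<le> B2 / 2 * (u - \<theta>)\<^sup>2" if u: "u \<in> {\<beta>..\<alpha>}" for u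
  proof (cases "u = \<theta>")
    case False
    define diff where "diff m = (if m = 0 then q else if m = Suc 0 then q' else q'')" for m :: nat
    have "\<exists>t. (if u < \<theta> then u < t \<and> t < \<theta> else \<theta> < t \<and> t < u) \<and>
        q u = (\<Sum>m<2. diff m \<theta> / fact m * (u - \<theta>) ^ m) + diff 2 t / fact 2 * (u - \<theta>) ^ 2"
      by (rule Taylor[of 2 diff q \<beta> \<alpha>])
         (use False u I(2) q' q'' in \<open>auto simp: diff_def less_2_cases_iff\<close>)
    then obtain t where t': "if u < \<theta> then u < t \<and> t < \<theta> else \<theta> < t \<and> t < u"
      and eq: "q u = (\<Sum>m<2. diff m \<theta> / fact m * (u - \<theta>) ^ m) + diff 2 t / fact 2 * (u - \<theta>) ^ 2"
      by blast
    have t: "t \<in> {\<beta>..\<alpha>}" using t' u I(2) by (auto split: if_splits)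
    have remainder: "q u - q \<theta> - q' \<theta> * (u - \<theta>) = q'' t * ((u - \<theta>)\<^sup>2 / 2)"
      using eq by (simp add: diff_def numeral_2_eq_2)
    show ?thesis
      unfolding remainder using mult_right_mono[OF B2[OF t], of "(u - \<theta>)\<^sup>2 / 2"]
      by (simp add: abs_mult)
  qed simp
  have "integral I (\<lambda>u. D u * K (u - \<theta>))
      = integral I (\<lambda>u. (q u - q \<theta> - q' \<theta> * (u - \<theta>)) * K (u - \<theta>) + q' \<theta> * ((u - \<theta>) * K (u - \<theta>)))"
  proof (rule integral_cong)
    fix u assume "u \<in> I"
    then have D_u: "D u = q u - q \<theta>" using I(1) by (auto simp: D_def)
    show "D u * K (u - \<theta>)
        = (q u - q \<theta> - q' \<theta> * (u - \<theta>)) * K (u - \<theta>) + q' \<theta> * ((u - \<theta>) * K (u - \<theta>))"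
      unfolding D_u by (simp add: algebra_simps)
  qed
  also have "\<dots> = integral I (\<lambda>u. (q u - q \<theta> - q' \<theta> * (u - \<theta>)) * K (u - \<theta>))
      + integral I (\<lambda>u. q' \<theta> * ((u - \<theta>) * K (u - \<theta>)))"
    unfolding I_def by (intro integral_add integrable_continuous_real continuous_intros cont)
  also have "integral I (\<lambda>u. q' \<theta> * ((u - \<theta>) * K (u - \<theta>))) = 0"
    using integral_odd_about[of "\<lambda>s. s * K s" \<theta> \<Delta>] by (simp add: even I_def)
  finally have center: "integral I (\<lambda>u. D u * K (u - \<theta>))
      = integral I (\<lambda>u. (q u - q \<theta> - q' \<theta> * (u - \<theta>)) * K (u - \<theta>))" by simp
  have "norm (integral I (\<lambda>u. D u * K (u - \<theta>))) \<le> integral I (\<lambda>u. B2 / 2 * ((u - \<theta>)\<^sup>2 * K (u - \<theta>)))"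
    unfolding center
  proof (rule integral_norm_bound_integral)
    fix u assume "u \<in> I"
    then show "norm ((q u - q \<theta> - q' \<theta> * (u - \<theta>)) * K (u - \<theta>)) \<le> B2 / 2 * ((u - \<theta>)\<^sup>2 * K (u - \<theta>))"
      using taylor[of u] I(1) mult_right_mono[OF taylor[of u] nonneg[of "u - \<theta>"]]
      by (auto simp: abs_mult nonneg mult.assoc)
  qed (auto simp: I_def intro!: integrable_continuous_real continuous_intros cont)
  also have "\<dots> = B2 / 2 * integral I (\<lambda>u. (u - \<theta>)\<^sup>2 * K (u - \<theta>))" by simp
  also have "\<dots> \<le> B2 / 2 * (pi\<^sup>2 / 2 * m2)"
    unfolding I_def using assms B20 by (intro mult_left_mono central_second_moment_le) auto
  finally show ?thesis using main by (simp add: I_def)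
qed

text \<open>The Cauchy--Schwarz inequality for the first moment appears as
  \<open>\<bar>s\<bar> \<le> s\<^sup>2 / (2 \<eta>) + \<eta> / 2\<close>.\<close>

lemma endpoint_bound:
  assumes "\<Delta> > 0" "\<beta> \<le> \<alpha> - \<Delta>" "0 \<le> \<beta>" "\<alpha> + \<Delta> \<le> pi" "\<eta> > 0" "pi\<^sup>2 / 2 * m2 \<le> \<eta>\<^sup>2"
    and q': "\<And>u. (q has_real_derivative q' u) (at u)"
    and B: "\<And>u. u \<in> {\<beta>..\<alpha>} \<Longrightarrow> \<bar>q u\<bar> \<le> B" and B1: "\<And>u. u \<in> {\<beta>..\<alpha>} \<Longrightarrow> \<bar>q' u\<bar> \<le> B1"
  shows "\<bar>integral {\<beta>..\<alpha>} (\<lambda>u. q u * folded \<alpha> u) - q \<alpha> / 2\<bar>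
    \<le> 2 * B * (pi ^ 4 / (4 * \<Delta> ^ 4) * m4) + B1 / 2 * \<eta>"
proof -
  define I where "I = {\<alpha> - \<Delta>..\<alpha> + \<Delta>}"
  define H where "H = {\<alpha> - \<Delta>..\<alpha>}"
  have H: "H \<subseteq> {\<beta>..\<alpha>}" "\<alpha> \<in> {\<beta>..\<alpha>}" using assms by (auto simp: H_def)
  have B0: "B \<ge> 0" using B[OF H(2)] by linarith
  have B10: "B1 \<ge> 0" using B1[OF H(2)] by linarith
  have cont: "continuous_on S q" for S
    using q' by (meson DERIV_isCont continuous_at_imp_continuous_on)
  define D where "D u = (if u \<in> {\<beta>..\<alpha>} then q u else 0) - q \<alpha> / 2" for u
  have D_le: "\<bar>D u\<bar> \<le> 2 * B" for u
    using B[of u] B[OF H(2)] B0 by (auto simp: D_def)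
  have main: "\<bar>integral {\<beta>..\<alpha>} (\<lambda>u. q u * folded \<alpha> u) - q \<alpha> / 2 - integral I (\<lambda>u. D u * K (u - \<alpha>))\<bar>
      \<le> 2 * B * (pi ^ 4 / (4 * \<Delta> ^ 4) * m4)"
    unfolding I_def by (rule localize[OF _ _ _ _ _ _ cont D_def D_le]) (use assms B0 in auto)
  have cap: "{\<beta>..\<alpha>} \<inter> I = H" using assms by (auto simp: I_def H_def)
  have qK: "(\<lambda>u. if u \<in> {\<beta>..\<alpha>} then q u * K (u - \<alpha>) else 0) integrable_on I"
    unfolding integrable_restrict_Int cap unfolding H_def
    by (intro integrable_continuous_real continuous_intros cont)
  have "integral I (\<lambda>u. D u * K (u - \<alpha>))
      = integral I (\<lambda>u. (if u \<in> {\<beta>..\<alpha>} then q u * K (u - \<alpha>) else 0) - q \<alpha> / 2 * K (u - \<alpha>))"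
    by (intro integral_cong) (simp add: D_def left_diff_distrib)
  also have "\<dots> = integral H (\<lambda>u. q u * K (u - \<alpha>)) - integral I (\<lambda>u. q \<alpha> / 2 * K (u - \<alpha>))"
  proof -
    have const: "(\<lambda>u. q \<alpha> / 2 * K (u - \<alpha>)) integrable_on I"
      unfolding I_def by (intro integrable_continuous_real continuous_intros)
    show ?thesis unfolding integral_diff[OF qK const] integral_restrict_Int cap ..
  qed
  \<comment> \<open>By evenness, half the value over the whole window equals the full value over its
    left half, where the function lives; this leaves the difference of q u and q alpha on that
    side.\<close>
  also have "integral I (\<lambda>u. q \<alpha> / 2 * K (u - \<alpha>)) = integral H (\<lambda>u. q \<alpha> * K (u - \<alpha>))"
    using integral_even_about[of \<Delta> K \<alpha>] assms continuous even by (simp add: I_def H_def)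
  also have "integral H (\<lambda>u. q u * K (u - \<alpha>)) - \<dots> = integral H (\<lambda>u. q u * K (u - \<alpha>) - q \<alpha> * K (u - \<alpha>))"
    unfolding H_def
    by (intro integral_diff[symmetric] integrable_continuous_real continuous_intros cont)
  finally have center: "integral I (\<lambda>u. D u * K (u - \<alpha>))
      = integral H (\<lambda>u. (q u - q \<alpha>) * K (u - \<alpha>))" by (simp add: left_diff_distrib)
  have lipschitz: "\<bar>q u - q \<alpha>\<bar> \<le> B1 * \<bar>u - \<alpha>\<bar>" if u: "u \<in> H" for u
  proof (cases "u = \<alpha>")
    case False
    then have "u < \<alpha>" using u by (simp add: H_def)
    then obtain t where t: "u < t" "t < \<alpha>" "q \<alpha> - q u = (\<alpha> - u) * q' t"
      using MVT2[of u \<alpha> q q'] q' by blast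
    then have "\<bar>q u - q \<alpha>\<bar> = \<bar>q' t\<bar> * \<bar>u - \<alpha>\<bar>" 
      by (simp add: abs_minus_commute[of "q u"] abs_minus_commute[of u] abs_mult)
    then show ?thesis using B1[of t] t u H(1) by (auto intro!: mult_right_mono)
  qed simp
  have "norm (integral I (\<lambda>u. D u * K (u - \<alpha>))) \<le> integral H (\<lambda>u. B1 * (\<bar>u - \<alpha>\<bar> * K (u - \<alpha>)))"
    unfolding center
  proof (rule integral_norm_bound_integral)
    fix u assume "u \<in> H"
    then show "norm ((q u - q \<alpha>) * K (u - \<alpha>)) \<le> B1 * (\<bar>u - \<alpha>\<bar> * K (u - \<alpha>))"
      using mult_right_mono[OF lipschitz nonneg[of "u - \<alpha>"]] by (simp add: abs_mult nonneg mult.assoc)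
  qed (auto simp: H_def intro!: integrable_continuous_real continuous_intros cont)
  \<comment> \<open>The moment bounds are about the whole window; by evenness, passing back to it
    produces the factor 1 / 2.\<close>
  also have "\<dots> = B1 / 2 * integral I (\<lambda>u. \<bar>u - \<alpha>\<bar> * K (u - \<alpha>))"
  proof -
    have "integral I (\<lambda>u. \<bar>u - \<alpha>\<bar> * K (u - \<alpha>)) = 2 * integral H (\<lambda>u. \<bar>u - \<alpha>\<bar> * K (u - \<alpha>))"
      unfolding I_def H_def using assms
      by (intro integral_even_about[of \<Delta> "\<lambda>s. \<bar>s\<bar> * K s" \<alpha>] continuous_intros) (auto simp: even)
    then show ?thesis by simp
  qed
  also have "integral I (\<lambda>u. \<bar>u - \<alpha>\<bar> * K (u - \<alpha>))
      \<le> integral I (\<lambda>u. 1 / (2 * \<eta>) * ((u - \<alpha>)\<^sup>2 * K (u - \<alpha>)) + \<eta> / 2 * K (u - \<alpha>))"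
    unfolding I_def
  proof (rule integral_le)
    fix u
    have "0 \<le> (\<bar>u - \<alpha>\<bar> - \<eta>)\<^sup>2" by simp
    then have "2 * \<bar>u - \<alpha>\<bar> * \<eta> \<le> (u - \<alpha>)\<^sup>2 + \<eta>\<^sup>2"
      unfolding power2_diff[of "\<bar>u - \<alpha>\<bar>"] power2_abs by linarith
    then have "\<bar>u - \<alpha>\<bar> \<le> ((u - \<alpha>)\<^sup>2 + \<eta>\<^sup>2) / (2 * \<eta>)"
      using assms(5) by (simp add: pos_le_divide_eq mult_ac)
    then have "\<bar>u - \<alpha>\<bar> \<le> 1 / (2 * \<eta>) * (u - \<alpha>)\<^sup>2 + \<eta> / 2"
      using assms(5) by (simp add: add_divide_distrib power2_eq_square[of \<eta>])
    from mult_right_mono[OF this nonneg]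
    show "\<bar>u - \<alpha>\<bar> * K (u - \<alpha>) \<le> 1 / (2 * \<eta>) * ((u - \<alpha>)\<^sup>2 * K (u - \<alpha>)) + \<eta> / 2 * K (u - \<alpha>)"
      by (simp only: distrib_right mult.assoc)
  qed (use assms(5) in \<open>auto intro!: integrable_continuous_real continuous_intros\<close>)
  also have "\<dots> = 1 / (2 * \<eta>) * integral I (\<lambda>u. (u - \<alpha>)\<^sup>2 * K (u - \<alpha>)) + \<eta> / 2 * integral I (\<lambda>u. K (u - \<alpha>))"
    unfolding I_def
    using assms(5)
    by (subst integral_add) (auto intro!: integrable_continuous_real continuous_intros)
  \<comment> \<open>As the square of \<open>\<eta>\<close> bounds the central second moment and the
    mass is at most 1, each summand contributes at most half of \<open>\<eta>\<close>.\<close>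
  also have "\<dots> \<le> 1 / (2 * \<eta>) * \<eta>\<^sup>2 + \<eta> / 2 * 1"
    using central_second_moment_le[of \<alpha> \<Delta>] central_mass_le[of \<alpha> \<Delta>] assms
    unfolding I_def by (intro add_mono mult_left_mono) auto
  also have "\<dots> = \<eta>" using assms(5) by (simp add: power2_eq_square)
  finally have "\<bar>integral I (\<lambda>u. D u * K (u - \<alpha>))\<bar> \<le> B1 / 2 * \<eta>"
    using B10 by (simp add: mult_left_mono)
  with main show ?thesis by linarith
qed

text \<open>The reflection u -> pi - u corresponds to t -> -t. It carries the left end of the arc to
  a right end, the kind that \<open>endpoint_bound\<close> treats.\<close>

lemma folded_integral_reflect:
  "integral {pi - \<alpha>..pi - \<beta>} (\<lambda>u. q (pi - u) * folded (pi - \<theta>) u)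
    = integral {\<beta>..\<alpha>} (\<lambda>u. q u * folded \<theta> u)"
proof -
  define g where "g u = q u * folded \<theta> u" for u
  have "integral {- \<alpha>..- \<beta>} (\<lambda>x. g (- x)) = integral {pi - \<alpha>..pi - \<beta>} (\<lambda>x. g (pi - x))"
    using integral_shift_real_ivl[of "pi - \<alpha>" pi "pi - \<beta>" "\<lambda>x. g (pi - x)"] by simp
  moreover have "q (pi - u) * folded (pi - \<theta>) u = g (pi - u)" for u
    using folded_reflect[of \<theta> "pi - u"] by (simp add: g_def)
  ultimately have "integral {pi - \<alpha>..pi - \<beta>} (\<lambda>u. q (pi - u) * folded (pi - \<theta>) u)
      = integral {\<beta>..\<alpha>} g"
    by (simp only: Henstock_Kurzweil_Integration.integral_reflect_real)
  then show ?thesis by (simp only: g_def[abs_def])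
qed

end

section \<open>The Chebyshev--Jackson series as a folded convolution\<close>

lemma poly_cheb_cos: "poly (cheb n) (cos t) = cos (real n * t)"
proof (induction n rule: cheb.induct)
  case (3 n)
  have "2 * cos t * cos (real (Suc n) * t) = cos (real (Suc (Suc n)) * t) + cos (real n * t)"
    using cos_times_cos[of "real (Suc n) * t" t] by (simp add: algebra_simps)
  then show ?case using 3 by simp
qed simp_all

text \<open>Substitution t = cos u. Because the integrand may be unbounded at -1 and 1, the
  antiderivative - G (arccos t) is fed to the form of the fundamental theorem that asks for
  differentiability in the open interval and mere continuity at its ends.\<close>

lemma cheb_coeff_eq:
  assumes "-1 \<le> a" "a \<le> b" "b \<le> 1"
  shows "cheb_coeff a b p j
    = 2 / pi * integral {arccos b..arccos a} (\<lambda>u. poly p (cos u) * cos (real j * u))"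
proof -
  define g where "g u = poly p (cos u) * cos (real j * u)" for u
  define G where "G x = integral {0..x} g" for x
  have g: "continuous_on S g" for S unfolding g_def by (intro continuous_intros)
  have G': "(G has_real_derivative g x) (at x within {0..pi})" if "x \<in> {0..pi}" for x
    unfolding G_def by (rule integral_has_real_derivative[OF g that])
  then have G_cont: "continuous_on {0..pi} G" by (rule DERIV_continuous_on)
  have "((\<lambda>t. poly p t * poly (cheb j) t / sqrt (1 - t\<^sup>2)) has_integral
      - G (arccos b) - (- G (arccos a))) {a..b}"
  proof (rule fundamental_theorem_of_calculus_interior)
    have "continuous_on {a..b} arccos"
      by (rule continuous_on_subset[OF continuous_on_arccos']) (use assms in auto)
    then have "continuous_on {a..b} (\<lambda>t. G (arccos t))"
      by (rule continuous_on_compose2[OF G_cont])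
         (use assms in \<open>auto intro!: arccos_lbound arccos_ubound\<close>)
    then show "continuous_on {a..b} (\<lambda>t. - G (arccos t))" by (intro continuous_intros)
    fix t assume "t \<in> {a<..<b}"
    then have t: "-1 < t" "t < 1" using assms by auto
    have "arccos t \<in> {0<..<pi}" using arccos_lt_bounded[OF t] by simp
    then have "(G has_real_derivative g (arccos t)) (at (arccos t))"
      using G'[of "arccos t"] at_within_Icc_at[of 0 "arccos t" pi] by simp
    from DERIV_chain2[OF this DERIV_arccos[OF t]]
    have "((\<lambda>t. - G (arccos t)) has_real_derivative
        - (g (arccos t) * inverse (- sqrt (1 - t\<^sup>2)))) (at t)"
      by (rule DERIV_minus)
    moreover have "g (arccos t) = poly p t * poly (cheb j) t"
      using t poly_cheb_cos[of j "arccos t"] by (simp add: g_def cos_arccos)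
    ultimately show "((\<lambda>t. - G (arccos t)) has_vector_derivative
        poly p t * poly (cheb j) t / sqrt (1 - t\<^sup>2)) (at t)"
      by (simp add: has_real_derivative_iff_has_vector_derivative divide_inverse)
  qed (use assms in auto)
  moreover have "G (arccos b) + integral {arccos b..arccos a} g = G (arccos a)"
    unfolding G_def using assms
    by (intro Henstock_Kurzweil_Integration.integral_combine integrable_continuous_real g)
       (auto intro: arccos_lbound arccos_le_mono[THEN iffD2] simp: abs_le_iff)
  ultimately show ?thesis
    by (simp add: cheb_coeff_def integral_unique g_def[abs_def])
qed

lemma CJ_series_cos:
  assumes "-1 \<le> a" "a \<le> b" "b \<le> 1"
  shows "poly (CJ_series a b d p) (cos \<theta>)
    = integral {arccos b..arccos a} (\<lambda>u. poly p (cos u) *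
        (jackson_kernel d (u - \<theta>) / pi + jackson_kernel d (u + \<theta>) / pi))"
proof -
  define g where "g j u = poly p (cos u) * cos (real j * u)" for j u
  define c where "c j = 2 / pi * (jackson_factor j d * cos (real j * \<theta>))" for j
  define I where "I = {arccos b..arccos a}"
  have g: "(g j has_integral integral I (g j)) I" for j
    unfolding I_def g_def by (intro integrable_integral integrable_continuous_real continuous_intros)
  have "((\<lambda>u. 1 / pi * g 0 u + (\<Sum>j=1..d. c j * g j u)) has_integral
      1 / pi * integral I (g 0) + (\<Sum>j=1..d. c j * integral I (g j))) I"
    by (intro has_integral_add has_integral_sum has_integral_mult_right g) auto
  moreover have "1 / pi * g 0 u + (\<Sum>j=1..d. c j * g j u)
      = poly p (cos u) * (jackson_kernel d (u - \<theta>) / pi + jackson_kernel d (u + \<theta>) / pi)" for u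
  proof -
    have "poly p (cos u) * (jackson_kernel d (u - \<theta>) / pi + jackson_kernel d (u + \<theta>) / pi)
        = poly p (cos u) / pi * (jackson_kernel d (u - \<theta>) + jackson_kernel d (u + \<theta>))"
      by (simp add: add_divide_distrib distrib_left)
    also have "\<dots> = poly p (cos u) / pi
        + (\<Sum>j=1..d. poly p (cos u) / pi * (2 * (jackson_factor j d * cos (real j * \<theta>) * cos (real j * u))))"
      unfolding jackson_kernel_folded by (simp only: distrib_left sum_distrib_left mult_1_right)
    also have "\<dots> = 1 / pi * g 0 u + (\<Sum>j=1..d. c j * g j u)"
      by (simp add: g_def c_def mult_ac)
    finally show ?thesis by simp
  qed
  ultimately have "integral I (\<lambda>u. poly p (cos u) *
        (jackson_kernel d (u - \<theta>) / pi + jackson_kernel d (u + \<theta>) / pi))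
      = 1 / pi * integral I (g 0) + (\<Sum>j=1..d. c j * integral I (g j))"
    by (simp only: integral_unique)
  also have "\<dots> = poly (CJ_series a b d p) (cos \<theta>)"
  proof -
    have coeff: "cheb_coeff a b p j = 2 / pi * integral I (g j)" for j
      using cheb_coeff_eq[OF assms] by (simp add: I_def g_def[abs_def])
    show ?thesis
      unfolding CJ_series_def poly_add poly_sum poly_smult coeff poly_cheb_cos c_def
      by (simp add: mult_ac)
  qed
  finally show ?thesis by (simp add: I_def)
qed

lemma jackson_even_kernel:
  assumes "d \<ge> 2"
  shows "even_kernel (\<lambda>s. jackson_kernel d s / pi) (1 - cos (jackson_alpha d))
    ((1 - cos (jackson_alpha d))\<^sup>2 + (sin (jackson_alpha d))\<^sup>2 / (real d + 2))"
proof
  show "continuous_on UNIV (\<lambda>s. jackson_kernel d s / pi)"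
    by (intro continuous_intros) simp
  show "0 \<le> jackson_kernel d s / pi" for s by (simp add: jackson_kernel_nonneg)
  show "jackson_kernel d (- s) / pi = jackson_kernel d s / pi" for s
    by (simp add: jackson_kernel_even)
  show "jackson_kernel d (2 * pi - s) / pi = jackson_kernel d s / pi" for s
    by (simp add: jackson_kernel_periodic)
  fix \<theta> :: real
  show "((\<lambda>u. jackson_kernel d (u - \<theta>) / pi + jackson_kernel d (u + \<theta>) / pi) has_integral 1) {0..pi}"
    using has_integral_mult_right[OF has_integral_jackson_kernel_folded, of "1 / pi"]
    by (simp add: add_divide_distrib)
  show "((\<lambda>u. (1 - cos (u - \<theta>)) * (jackson_kernel d (u - \<theta>) / pi)
        + (1 - cos (u + \<theta>)) * (jackson_kernel d (u + \<theta>) / pi))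
      has_integral 1 - cos (jackson_alpha d)) {0..pi}"
    using has_integral_mult_right[OF has_integral_jackson_second_moment, of d "1 / pi"] assms
    by (simp add: add_divide_distrib)
  show "((\<lambda>u. (1 - cos (u - \<theta>))\<^sup>2 * (jackson_kernel d (u - \<theta>) / pi)
        + (1 - cos (u + \<theta>))\<^sup>2 * (jackson_kernel d (u + \<theta>) / pi))
      has_integral (1 - cos (jackson_alpha d))\<^sup>2 + (sin (jackson_alpha d))\<^sup>2 / (real d + 2)) {0..pi}"
    using has_integral_mult_right[OF has_integral_jackson_fourth_moment, of d "1 / pi"] assms
    by (simp add: add_divide_distrib)
qed

section \<open>Gaps between the spectrum and the ends of the interval\<close>

lemma closest_in_mem: "closest_in S c x \<Longrightarrow> x \<in> S"
  by (simp add: closest_in_def is_arg_min_def)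

lemma closest_in_le: "closest_in S c x \<Longrightarrow> y \<in> S \<Longrightarrow> \<bar>x - c\<bar> \<le> \<bar>y - c\<bar>"
  by (auto simp: closest_in_def is_arg_min_def not_less)

lemma closest_in_uminus:
  assumes "closest_in S c x"
  shows "closest_in (uminus ` S) (- c) (- x)"
  using closest_in_mem[OF assms] closest_in_le[OF assms]
  by (fastforce simp: closest_in_def is_arg_min_def not_less)

lemma delta_min_uminus:
  assumes "{a, b, l_ia, l_oa, l_ib, l_ob} \<subseteq> {-1..1}"
  shows "delta_min (- b) (- a) (- l_ib) (- l_ob) (- l_ia) (- l_oa) = delta_min a b l_ia l_oa l_ib l_ob"
proof -
  have "\<bar>arccos (- x) - arccos (- y)\<bar> = \<bar>arccos x - arccos y\<bar>" if "x \<in> {-1..1}" "y \<in> {-1..1}" for x y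
    using that by (simp add: arccos_minus abs_minus_commute)
  then show ?thesis
    using assms unfolding delta_min_def by (simp add: insert_commute)
qed

lemma delta_min_le:
  "delta_min a b l_ia l_oa l_ib l_ob \<le> \<bar>arccos a - arccos l_ia\<bar>"
  "delta_min a b l_ia l_oa l_ib l_ob \<le> \<bar>arccos a - arccos l_oa\<bar>"
  "delta_min a b l_ia l_oa l_ib l_ob \<le> \<bar>arccos b - arccos l_ib\<bar>"
  "delta_min a b l_ia l_oa l_ib l_ob \<le> \<bar>arccos b - arccos l_ob\<bar>"
  unfolding delta_min_def by simp_all

text \<open>The estimate depends on the matrix only through the position of its eigenvalues. These
  data are stable under t -> -t, which later transfers the gaps at \<open>a\<close> to
  \<open>b\<close>.\<close>

locale separated_spectrum =
  fixes S :: "real set" and a b l_ia l_oa l_ib l_ob :: real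
  assumes S: "S \<subseteq> {-1..1}" and ab: "-1 \<le> a" "a < b" "b \<le> 1"
    and ia: "closest_in (S \<inter> {a<..<b}) a l_ia" and ib: "closest_in (S \<inter> {a<..<b}) b l_ib"
    and oa: "closest_in (S - {a..b}) a l_oa" and ob: "closest_in (S - {a..b}) b l_ob"
begin

abbreviation "\<Delta> \<equiv> delta_min a b l_ia l_oa l_ib l_ob"

lemma l_mem: "l_ia \<in> {a<..<b}" "l_ib \<in> {a<..<b}" "l_oa \<notin> {a..b}" "l_ob \<notin> {a..b}"
  "{l_ia, l_ib, l_oa, l_ob} \<subseteq> {-1..1}"
  using closest_in_mem[OF ia] closest_in_mem[OF ib] closest_in_mem[OF oa] closest_in_mem[OF ob] S
  by auto

text \<open>Inside eigenvalues come from the open interval and outside ones from the complement of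
  the closed one, so none of the four equals \<open>a\<close> or \<open>b\<close>, even if an end is
  itself an eigenvalue; arccos is injective.\<close>

lemma delta_pos: "\<Delta> > 0"
proof -
  have "arccos x \<noteq> arccos y" if "x \<in> {-1..1}" "y \<in> {-1..1}" "x \<noteq> y" for x y
    using that arccos_eq_iff[of x y] by (auto simp: abs_le_iff)
  then show ?thesis using l_mem ab unfolding delta_min_def by (auto simp: less_le[of 0])
qed

lemma inside_gap_a:
  assumes "lam \<in> S" "lam \<in> {a<..<b}"
  shows "\<Delta> \<le> arccos a - arccos lam"
proof -
  have "l_ia \<le> lam" using closest_in_le[OF ia, of lam] l_mem assms by auto
  then have "arccos lam \<le> arccos l_ia" using assms l_mem ab by (intro arccos_le_arccos) auto
  moreover have "arccos l_ia \<le> arccos a" using l_mem ab by (intro arccos_le_arccos) auto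
  ultimately show ?thesis using delta_min_le(1)[of a b l_ia l_oa l_ib l_ob] by linarith
qed

text \<open>If \<open>l_oa\<close> lies on the far side of \<open>[a,b]\<close>, then so does \<open>l_ob\<close>, and \<open>\<Delta>\<close> is at most a third of
  \<open>arccos a - arccos l_oa\<close>, because \<open>l_ia \<le> l_ib < b < l_ob \<le> l_oa\<close>.\<close>

lemma outside_gap_a:
  assumes lam: "lam \<in> S" "lam < a"
  shows "\<Delta> \<le> arccos lam - arccos a"
proof -
  have lam1: "-1 \<le> lam" using S lam by auto
  have lam_oa: "\<bar>l_oa - a\<bar> \<le> a - lam" using closest_in_le[OF oa, of lam] lam by auto
  show ?thesis
  proof (cases "l_oa < a")
    case True
    then have "lam \<le> l_oa" using lam_oa by auto
    then have "arccos l_oa \<le> arccos lam" using lam1 True ab by (intro arccos_le_arccos) auto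
    moreover have "arccos a \<le> arccos l_oa" using True l_mem ab by (intro arccos_le_arccos) auto
    ultimately show ?thesis using delta_min_le(2)[of a b l_ia l_oa l_ib l_ob] by linarith
  next
    case False
    then have oa_gt: "b < l_oa" using l_mem by auto
    have ob_le: "\<bar>l_ob - b\<bar> \<le> \<bar>l_oa - b\<bar>"
      using closest_in_le[OF ob closest_in_mem[OF oa]] .
    have oa_le: "\<bar>l_oa - a\<bar> \<le> \<bar>l_ob - a\<bar>"
      using closest_in_le[OF oa closest_in_mem[OF ob]] .
    \<comment> \<open>Otherwise the two minimality inequalities read b - l_ob <= l_oa - b and l_oa -
      a <= a - l_ob, and together they give b <= a.\<close>
    have "\<not> l_ob < a" using ob_le oa_le oa_gt ab by auto
    then have ob_gt: "b < l_ob" "l_ob \<le> l_oa" using l_mem ob_le oa_gt by auto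
    have ia_le: "l_ia \<le> l_ib" using closest_in_le[OF ia closest_in_mem[OF ib]] l_mem by auto
    have "arccos l_ia \<le> arccos a" "arccos l_ib \<le> arccos l_ia" "arccos b \<le> arccos l_ib"
      "arccos l_ob \<le> arccos b" "arccos l_oa \<le> arccos l_ob"
      using ob_gt ia_le l_mem ab by (auto intro!: arccos_le_arccos)
    then have third: "3 * \<Delta> \<le> arccos a - arccos l_oa"
      using delta_min_le[of a b l_ia l_oa l_ib l_ob] by linarith
    \<comment> \<open>In t, \<open>l_oa\<close> is at most as far from \<open>a\<close> as
      \<open>lam\<close> is, but arccos does not preserve distances. The distortion costs at most
      the factor 3 that \<open>third\<close> has in hand.\<close>
    have "arccos a - arccos l_oa \<le> 3 * (arccos lam - arccos a)"
    proof (rule cos_gap_reflect)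
      show "0 \<le> arccos l_oa" using l_mem by (intro arccos_lbound) auto
      show "arccos l_oa < arccos a" using l_mem oa_gt ab by (intro arccos_less_arccos) auto
      show "arccos a \<le> arccos lam" using lam lam1 ab by (intro arccos_le_arccos) auto
      show "arccos lam \<le> pi" using lam lam1 ab by (intro arccos_ubound) auto
      show "cos (arccos l_oa) - cos (arccos a) \<le> cos (arccos a) - cos (arccos lam)"
        using lam lam1 lam_oa oa_gt ab l_mem by (simp add: cos_arccos)
    qed
    with third have "3 * \<Delta> \<le> 3 * (arccos lam - arccos a)" by (rule order.trans)
    then show ?thesis by simp
  qed
qed

lemma reflected: "separated_spectrum (uminus ` S) (- b) (- a) (- l_ib) (- l_ob) (- l_ia) (- l_oa)"
proof
  have "uminus ` (S \<inter> {a<..<b}) = uminus ` S \<inter> {- b<..<- a}"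
    "uminus ` (S - {a..b}) = uminus ` S - {- b..- a}" by auto
  then show "closest_in (uminus ` S \<inter> {- b<..<- a}) (- b) (- l_ib)"
    "closest_in (uminus ` S \<inter> {- b<..<- a}) (- a) (- l_ia)"
    "closest_in (uminus ` S - {- b..- a}) (- b) (- l_ob)"
    "closest_in (uminus ` S - {- b..- a}) (- a) (- l_oa)"
    using closest_in_uminus[OF ia] closest_in_uminus[OF ib] closest_in_uminus[OF oa]
      closest_in_uminus[OF ob] by auto
qed (use S ab in auto)

lemma delta_reflected: "delta_min (- b) (- a) (- l_ib) (- l_ob) (- l_ia) (- l_oa) = \<Delta>"
  using l_mem ab by (intro delta_min_uminus) auto

lemma inside_gap_b:
  assumes "lam \<in> S" "lam \<in> {a<..<b}"
  shows "\<Delta> \<le> arccos lam - arccos b"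
  using separated_spectrum.inside_gap_a[OF reflected, of "- lam"] assms ab
  by (simp add: delta_reflected arccos_minus)

lemma outside_gap_b:
  assumes "lam \<in> S" "b < lam"
  shows "\<Delta> \<le> arccos b - arccos lam"
  using separated_spectrum.outside_gap_a[OF reflected, of "- lam"] assms ab S
  by (force simp: delta_reflected arccos_minus)

end

section \<open>The error bound\<close>

text \<open>The norm is a supremum over the open interval, whereas Markov's inequality and the
  values at the jumps need the closed one; continuity bridges the two.\<close>

lemma abs_poly_le_sup_norm:
  assumes "a < b" "x \<in> {a..b}"
  shows "\<bar>poly p x\<bar> \<le> sup_norm a b (poly p)"
proof -
  have "compact ((\<lambda>t. \<bar>poly p t\<bar>) ` {a..b})"
    by (intro compact_continuous_image continuous_intros) simp
  then have "bdd_above ((\<lambda>t. \<bar>poly p t\<bar>) ` {a..b})"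
    by (intro bounded_imp_bdd_above compact_imp_bounded)
  then have "bdd_above ((\<lambda>t. \<bar>poly p t\<bar>) ` {a<..<b})"
    by (rule bdd_above_mono) auto
  then have *: "\<bar>poly p t\<bar> \<le> sup_norm a b (poly p)" if "t \<in> {a<..<b}" for t
    unfolding sup_norm_def using that by (intro cSUP_upper)
  show ?thesis
    by (rule continuous_le_on_closure[of "{a<..<b}" "\<lambda>t. \<bar>poly p t\<bar>"])
       (use assms * in \<open>auto intro!: continuous_intros\<close>)
qed

lemma poly_cos_derivs:
  "((\<lambda>u. poly p (cos u)) has_real_derivative - sin u * poly (pderiv p) (cos u)) (at u)"
  "((\<lambda>u. - sin u * poly (pderiv p) (cos u)) has_real_derivative
      (sin u)\<^sup>2 * poly (pderiv (pderiv p)) (cos u) - cos u * poly (pderiv p) (cos u)) (at u)"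
  by (auto intro!: derivative_eq_intros simp: power2_eq_square algebra_simps)

lemma poly_cos_derivs_bound:
  fixes p :: "real poly"
  assumes ab: "a < b" "b - a \<le> 2" and p: "degree p \<le> N"
    and B: "\<And>x. x \<in> {a..b} \<Longrightarrow> \<bar>poly p x\<bar> \<le> B" and u: "cos u \<in> {a..b}"
  shows "\<bar>- sin u * poly (pderiv p) (cos u)\<bar> \<le> 2 * (real N)\<^sup>2 / (b - a) * B"
    and "\<bar>(sin u)\<^sup>2 * poly (pderiv (pderiv p)) (cos u) - cos u * poly (pderiv p) (cos u)\<bar>
           \<le> 4 * real N ^ 4 / (b - a)\<^sup>2 * B"
proof -
  define L where "L = b - a"
  define B1 where "B1 = 2 * (real N)\<^sup>2 / L * B"
  have L: "L > 0" "L \<le> 2" using ab by (auto simp: L_def)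
  have p': "\<bar>poly (pderiv p) x\<bar> \<le> B1" if "x \<in> {a..b}" for x
    unfolding B1_def L_def using markov_inequality_Icc[OF ab(1) p B that] by simp
  have B1: "B1 \<ge> 0" using p'[OF u] by linarith
  have p'': "\<bar>poly (pderiv (pderiv p)) (cos u)\<bar> \<le> 2 * (real (N - 1))\<^sup>2 / L * B1"
    unfolding L_def using p
    by (intro markov_inequality_Icc[OF ab(1) _ p' u]) (simp_all add: degree_pderiv)
  have "\<bar>sin u\<bar> * \<bar>poly (pderiv p) (cos u)\<bar> \<le> 1 * B1"
    using p'[OF u] by (intro mult_mono) auto
  then show "\<bar>- sin u * poly (pderiv p) (cos u)\<bar> \<le> 2 * (real N)\<^sup>2 / (b - a) * B"
    by (simp add: abs_mult B1_def L_def)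
  have "\<bar>(sin u)\<^sup>2 * poly (pderiv (pderiv p)) (cos u) - cos u * poly (pderiv p) (cos u)\<bar>
      \<le> \<bar>(sin u)\<^sup>2 * poly (pderiv (pderiv p)) (cos u)\<bar> + \<bar>cos u * poly (pderiv p) (cos u)\<bar>"
    by (rule abs_triangle_ineq4)
  also have "\<dots> \<le> 1 * (2 * (real (N - 1))\<^sup>2 / L * B1) + 1 * B1"
    unfolding abs_mult using p'[OF u] p'' by (intro add_mono mult_mono) (auto simp: abs_square_le_1)
  \<comment> \<open>Markov's inequality for p' has N - 1 in place of N, and (N - 1)^2 + 1 <= N^2
    leaves room for the first-order term, whose coefficient 1 is at most 2 / L. For N = 0 the bound
    \<open>B1\<close> is 0.\<close>
  also have "\<dots> \<le> 2 * (real N)\<^sup>2 / L * B1"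
  proof (cases "N = 0")
    case True
    then show ?thesis by (simp add: B1_def)
  next
    case False
    then have "(real (N - 1))\<^sup>2 + 1 \<le> (real N)\<^sup>2"
      by (simp add: of_nat_diff power2_eq_square algebra_simps)
    then have "2 / L * ((real (N - 1))\<^sup>2 + 1) \<le> 2 / L * (real N)\<^sup>2"
      using L by (intro mult_left_mono) auto
    moreover have "1 \<le> 2 / L" using L by simp
    ultimately have "2 * (real (N - 1))\<^sup>2 / L + 1 \<le> 2 * (real N)\<^sup>2 / L"
      by (simp add: distrib_left)
    from mult_right_mono[OF this B1] show ?thesis by (simp add: distrib_right)
  qed
  also have "\<dots> = 4 * real N ^ 4 / (b - a)\<^sup>2 * B"
    by (simp add: B1_def L_def power2_eq_square power4_eq_xxxx)
  finally show "\<bar>(sin u)\<^sup>2 * poly (pderiv (pderiv p)) (cos u) - cos u * poly (pderiv p) (cos u)\<bar>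
      \<le> 4 * real N ^ 4 / (b - a)\<^sup>2 * B" .
qed

theorem theorem4p4:
  fixes A :: "real mat" and n M d :: nat and a b :: real
    and l_ia l_ib l_oa l_ob lam :: real and p :: "real poly"
  assumes "A \<in> carrier_mat n n"
    and "transpose_mat A = A"
    and "Min (spectrum A) = -1" and "Max (spectrum A) = 1"
    and "{a..b} \<subseteq> {Min (spectrum A)..Max (spectrum A)}" and "a < b"
    and "closest_in (spectrum A \<inter> {a<..<b}) a l_ia"
    and "closest_in (spectrum A \<inter> {a<..<b}) b l_ib"
    and "closest_in (spectrum A - {a..b}) a l_oa"
    and "closest_in (spectrum A - {a..b}) b l_ob"
    and "M \<ge> 1" and "degree p \<le> M - 1"
    and "lam \<in> spectrum A" and "d \<ge> 2"
    (* h jumps at lam in {a,b}; when lam is -1 or 1 the series has no jump there *)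
    and "lam \<in> {a, b} \<Longrightarrow> lam \<notin> {-1, 1}"
  shows "\<bar>poly (CJ_series a b d p) lam - poly p lam * step_fun a b lam\<bar>
    \<le> pi ^ 6 * sup_norm a b (poly p)
        / (delta_min a b l_ia l_oa l_ib l_ob ^ 4 * (real d + 2) ^ 3)
      + (if lam \<notin> {a..b} then 0
         else if lam \<in> {a<..<b} then
           pi ^ 4 * (real M - 1) ^ 4 * sup_norm a b (poly p)
             / (2 * (b - a)\<^sup>2 * (real d + 2)\<^sup>2)
         else
           pi\<^sup>2 * (real M - 1)\<^sup>2 * sup_norm a b (poly p)
             / (2 * (b - a) * (real d + 2)))"
proof -
  define S where "S = spectrum A"
  have finite: "finite S" unfolding S_def using card_finite_spectrum(1)[OF assms(1)] .
  have nonempty: "S \<noteq> {}" using assms(13) by (auto simp: S_def)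
  have S: "S \<subseteq> {-1..1}"
    using Min_le[OF finite] Max_ge[OF finite] assms(3,4) by (auto simp: S_def)
  have ends: "-1 \<in> S" "1 \<in> S"
    using Min_in[OF finite nonempty] Max_in[OF finite nonempty] assms(3,4) by (auto simp: S_def)
  have ab: "-1 \<le> a" "a < b" "b \<le> 1" using assms(3-6) by auto
  have lam: "lam \<in> S" using assms(13) by (simp add: S_def)
  interpret separated_spectrum S a b l_ia l_oa l_ib l_ob
    by unfold_locales (use S ab assms(7-10) in \<open>auto simp: S_def\<close>)
  define m2 where "m2 = 1 - cos (jackson_alpha d)"
  define m4 where "m4 = (1 - cos (jackson_alpha d))\<^sup>2 + (sin (jackson_alpha d))\<^sup>2 / (real d + 2)"
  interpret K: even_kernel "\<lambda>s. jackson_kernel d s / pi" m2 m4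
    unfolding m2_def m4_def by (rule jackson_even_kernel[OF assms(14)])
  define N where "N = M - 1"
  define B where "B = sup_norm a b (poly p)"
  define D where "D = real d + 2"
  \<comment> \<open>Chosen so that its square is (pi^2 / 2) (pi^2 / (2 D^2)), the bound on the
    central second moment.\<close>
  define \<eta> where "\<eta> = pi\<^sup>2 / (2 * D)"
  define \<alpha> where "\<alpha> = arccos a"
  define \<beta> where "\<beta> = arccos b"
  define \<theta> where "\<theta> = arccos lam"
  define q where "q u = poly p (cos u)" for u
  define q' where "q' u = - sin u * poly (pderiv p) (cos u)" for u
  define q'' where "q'' u = (sin u)\<^sup>2 * poly (pderiv (pderiv p)) (cos u) - cos u * poly (pderiv p) (cos u)" for u
  define far where "far = pi ^ 6 * B / (\<Delta> ^ 4 * D ^ 3)"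
  have D: "D > 0" by (simp add: D_def)
  have \<eta>: "\<eta> > 0" using D by (simp add: \<eta>_def)
  have N: "real M - 1 = real N" using assms(11) by (simp add: N_def of_nat_diff)
  have p_le: "\<bar>poly p x\<bar> \<le> B" if "x \<in> {a..b}" for x
    unfolding B_def by (rule abs_poly_le_sup_norm[OF ab(2) that])
  have B: "B \<ge> 0" using p_le[of a] ab by auto
  have angles: "0 \<le> \<beta>" "\<beta> \<le> \<alpha>" "\<alpha> \<le> pi" "\<theta> \<in> {0..pi}" "cos \<theta> = lam" "cos \<alpha> = a" "cos \<beta> = b"
    using ab lam S by (auto simp: \<alpha>_def \<beta>_def \<theta>_def cos_arccos
        intro!: arccos_lbound arccos_ubound arccos_le_arccos)
  have cos_mem: "cos u \<in> {a..b}" if "u \<in> {\<beta>..\<alpha>}" for u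
    using cos_monotone_0_pi_le[of u \<alpha>] cos_monotone_0_pi_le[of \<beta> u] that angles by auto
  have q_le: "\<bar>q u\<bar> \<le> B" "\<bar>q' u\<bar> \<le> 2 * (real N)\<^sup>2 / (b - a) * B"
    "\<bar>q'' u\<bar> \<le> 4 * real N ^ 4 / (b - a)\<^sup>2 * B" if "u \<in> {\<beta>..\<alpha>}" for u
    unfolding q_def q'_def q''_def
    using p_le[OF cos_mem[OF that]] poly_cos_derivs_bound[of a b p N B u] cos_mem[OF that] p_le
      ab assms(12) by (auto simp: N_def)
  have q': "(q has_real_derivative q' u) (at u)" and q'': "(q' has_real_derivative q'' u) (at u)" for u
    unfolding q_def[abs_def] q'_def[abs_def] q''_def by (rule poly_cos_derivs)+
  have q_cont: "continuous_on X q" for X unfolding q_def by (intro continuous_intros)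
  have series: "poly (CJ_series a b d p) lam = integral {\<beta>..\<alpha>} (\<lambda>u. q u * K.folded \<theta> u)"
    using CJ_series_cos[of a b d p \<theta>] ab angles
    by (simp add: q_def K.folded_def \<alpha>_def \<beta>_def)
  have m2: "pi\<^sup>2 / 2 * m2 \<le> \<eta>\<^sup>2"
  proof -
    have "pi\<^sup>2 / 2 * m2 \<le> pi\<^sup>2 / 2 * (pi\<^sup>2 / (2 * D\<^sup>2))"
      unfolding m2_def D_def by (intro mult_left_mono jackson_second_moment_le) simp
    also have "\<dots> = \<eta>\<^sup>2" by (simp add: \<eta>_def power_divide power_mult_distrib power2_eq_square)
    finally show ?thesis .
  qed
  \<comment> \<open>The constants 2 (a difference of values bounded by B), pi^4 / 4 (the far weight)
    and 2 pi^2 (the fourth moment) multiply to pi^6.\<close>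
  have tail: "2 * B * (pi ^ 4 / (4 * \<Delta> ^ 4) * m4) \<le> far"
  proof -
    have "m4 \<le> 2 * pi\<^sup>2 / D ^ 3"
      unfolding m4_def D_def by (rule jackson_fourth_moment_le[OF assms(14)])
    then have "2 * B * (pi ^ 4 / (4 * \<Delta> ^ 4) * m4) \<le> 2 * B * (pi ^ 4 / (4 * \<Delta> ^ 4) * (2 * pi\<^sup>2 / D ^ 3))"
      using B by (intro mult_left_mono) auto
    also have "\<dots> = far" by (simp add: far_def field_simps flip: power_add)
    finally show ?thesis .
  qed
  consider "lam \<notin> {a..b}" | "lam \<in> {a<..<b}" | "lam = a" | "lam = b" using ab by force
  then have "\<bar>poly (CJ_series a b d p) lam - poly p lam * step_fun a b lam\<bar>
    \<le> far + (if lam \<notin> {a..b} then 0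
        else if lam \<in> {a<..<b} then pi ^ 4 * real N ^ 4 * B / (2 * (b - a)\<^sup>2 * D\<^sup>2)
        else pi\<^sup>2 * (real N)\<^sup>2 * B / (2 * (b - a) * D))"
  proof cases
    case 1
    have distant: "\<Delta> \<le> \<bar>u - \<theta>\<bar>" if "u \<in> {\<beta>..\<alpha>}" for u
    proof (cases "lam < a")
      case True
      then show ?thesis using outside_gap_a[OF lam] that by (auto simp: \<alpha>_def \<theta>_def)
    next
      case False
      then have "b < lam" using 1 by auto
      then show ?thesis using outside_gap_b[OF lam] that by (auto simp: \<beta>_def \<theta>_def)
    qed
    have "\<bar>poly (CJ_series a b d p) lam\<bar> \<le> B * (pi ^ 4 / (4 * \<Delta> ^ 4) * m4)"
      unfolding series
      by (rule K.outside_bound) (use angles delta_pos B q_cont q_le(1) distant in auto)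
    moreover have "\<dots> \<le> 2 * B * (pi ^ 4 / (4 * \<Delta> ^ 4) * m4)"
      using B by (intro mult_right_mono) (auto simp: m4_def)
    moreover have "step_fun a b lam = 0" using 1 ab by (auto simp: step_fun_def)
    ultimately show ?thesis using tail 1 by auto
  next
    case 2
    have "\<bar>poly (CJ_series a b d p) lam - q \<theta>\<bar>
        \<le> 2 * B * (pi ^ 4 / (4 * \<Delta> ^ 4) * m4) + (4 * real N ^ 4 / (b - a)\<^sup>2 * B) / 2 * (pi\<^sup>2 / 2 * m2)"
      unfolding series
      by (rule K.interior_bound[OF delta_pos _ _ _ _ q' q'' q_le(1) q_le(3)])
         (use inside_gap_a[OF lam 2] inside_gap_b[OF lam 2] angles in \<open>auto simp: \<alpha>_def \<beta>_def \<theta>_def\<close>)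
    also have "\<dots> \<le> far + (4 * real N ^ 4 / (b - a)\<^sup>2 * B) / 2 * \<eta>\<^sup>2"
      using B by (intro add_mono tail mult_left_mono m2) auto
    also have "(4 * real N ^ 4 / (b - a)\<^sup>2 * B) / 2 * \<eta>\<^sup>2 = pi ^ 4 * real N ^ 4 * B / (2 * (b - a)\<^sup>2 * D\<^sup>2)"
      by (simp add: \<eta>_def power_divide power_mult_distrib mult_ac flip: power_mult)
    finally show ?thesis using 2 by (simp add: step_fun_def q_def angles)
  next
    case 3
    \<comment> \<open>The eigenvalue -1 now lies outside [a,b], and its gap leaves room in [0, pi]
      for the right half of the window.\<close>
    then have "-1 < a" using assms(15) ab by auto
    then have gap: "\<alpha> + \<Delta> \<le> pi"
      using outside_gap_a[OF ends(1)] by (simp add: \<alpha>_def)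
    \<comment> \<open>The eigenvalue \<open>l_ia\<close> inside (a,b) makes the arc at least as long
      as the left half of the window.\<close>
    have \<Delta>_le: "\<beta> \<le> \<alpha> - \<Delta>"
      using inside_gap_a[of l_ia] closest_in_mem[OF ia] arccos_le_arccos[of l_ia b] l_mem ab
      by (auto simp: \<alpha>_def \<beta>_def)
    have at_\<alpha>: "\<theta> = \<alpha>" using 3 by (simp add: \<theta>_def \<alpha>_def)
    have "\<bar>poly (CJ_series a b d p) lam - q \<alpha> / 2\<bar>
        \<le> 2 * B * (pi ^ 4 / (4 * \<Delta> ^ 4) * m4) + (2 * (real N)\<^sup>2 / (b - a) * B) / 2 * \<eta>"
      unfolding series at_\<alpha>
      by (rule K.endpoint_bound[OF delta_pos \<Delta>_le angles(1) gap \<eta> m2 q' q_le(1) q_le(2)])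
    also have "\<dots> \<le> far + (2 * (real N)\<^sup>2 / (b - a) * B) / 2 * \<eta>" using tail by simp
    also have "(2 * (real N)\<^sup>2 / (b - a) * B) / 2 * \<eta> = pi\<^sup>2 * (real N)\<^sup>2 * B / (2 * (b - a) * D)"
      by (simp add: \<eta>_def mult_ac)
    finally show ?thesis using 3 ab by (simp add: step_fun_def q_def angles)
  next
    case 4
    then have "b < 1" using assms(15) ab by auto
    then have gap: "pi - \<beta> + \<Delta> \<le> pi"
      using outside_gap_b[OF ends(2)] by (simp add: \<beta>_def)
    have \<Delta>_le: "pi - \<alpha> \<le> pi - \<beta> - \<Delta>"
      using inside_gap_b[of l_ib] closest_in_mem[OF ib] arccos_le_arccos[of a l_ib] l_mem ab
      by (auto simp: \<alpha>_def \<beta>_def)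
    have "\<theta> = \<beta>" using 4 by (simp add: \<theta>_def \<beta>_def)
    \<comment> \<open>Reflection turns this into the previous case, at the right end pi - beta of
      the reflected arc; the derivative changes only its sign.\<close>
    then have "poly (CJ_series a b d p) lam
        = integral {pi - \<alpha>..pi - \<beta>} (\<lambda>u. q (pi - u) * K.folded (pi - \<beta>) u)"
      unfolding series K.folded_integral_reflect by simp
    moreover have "\<bar>integral {pi - \<alpha>..pi - \<beta>} (\<lambda>u. q (pi - u) * K.folded (pi - \<beta>) u) - q (pi - (pi - \<beta>)) / 2\<bar>
        \<le> 2 * B * (pi ^ 4 / (4 * \<Delta> ^ 4) * m4) + (2 * (real N)\<^sup>2 / (b - a) * B) / 2 * \<eta>"
    proof (rule K.endpoint_bound[OF delta_pos \<Delta>_le _ gap \<eta> m2])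
      show "((\<lambda>u. q (pi - u)) has_real_derivative - q' (pi - u)) (at u)" for u
      proof -
        have "((\<lambda>u. pi - u) has_real_derivative - 1) (at u)"
          by (auto intro!: derivative_eq_intros)
        from DERIV_chain2[OF q' this] show ?thesis by simp
      qed
      show "0 \<le> pi - \<alpha>" using angles by simp
      fix u assume "u \<in> {pi - \<alpha>..pi - \<beta>}"
      then have u: "pi - u \<in> {\<beta>..\<alpha>}" by auto
      show "\<bar>q (pi - u)\<bar> \<le> B" by (rule q_le(1)[OF u])
      show "\<bar>- q' (pi - u)\<bar> \<le> 2 * (real N)\<^sup>2 / (b - a) * B"
        unfolding abs_minus_cancel by (rule q_le(2)[OF u])
    qed
    ultimately have "\<bar>poly (CJ_series a b d p) lam - q \<beta> / 2\<bar>
        \<le> 2 * B * (pi ^ 4 / (4 * \<Delta> ^ 4) * m4) + (2 * (real N)\<^sup>2 / (b - a) * B) / 2 * \<eta>"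
      by simp
    also have "\<dots> \<le> far + (2 * (real N)\<^sup>2 / (b - a) * B) / 2 * \<eta>" using tail by simp
    also have "(2 * (real N)\<^sup>2 / (b - a) * B) / 2 * \<eta> = pi\<^sup>2 * (real N)\<^sup>2 * B / (2 * (b - a) * D)"
      by (simp add: \<eta>_def mult_ac)
    finally show ?thesis using 4 ab by (simp add: step_fun_def q_def angles)
  qed
  then show ?thesis unfolding N far_def B_def D_def .
qed

end
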